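(* Let $H$ be a finite graph with at least one vertex, and let $r$ be an integer with $r\ge 40v(H)^3$. Then $\mathrm{inj}(H,G)\le \mathrm{inj}(H,T_r(n))$ for every positive integer $n$ and every $n$-vertex $K_{r+1}$-free graph $G$.
   Context: All graphs are finite and simple. $v(H)$ is the number of vertices of $H$. $\mathrm{inj}(H,G)$ is the number of injective maps $\varphi:V(H)\to V(G)$ such that $\varphi(x)\varphi(y)\in E(G)$ whenever $xy\in E(H)$. A graph is $K_{r+1}$-free if it does not contain the complete graph $K_{r+1}$ as a subgraph. $T_r(n)$ is the Turán graph: the complete $r$-partite graph on $n$ vertices whose part sizes are $\lfloor n/r\rfloor$ or $\lceil n/r\rceil$ (parts may be empty if $n<r$). *)

theory Defs
  imports Complex_Main "HOL-Library.FuncSet" "HOL-Library.Disjoint_Sets" "Graph_Theory.Graph_Theory"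
begin

text \<open>
  A finite simple graph is a \<^locale>\<open>pair_graph\<close>: a finite vertex set together with a
  symmetric, irreflexive edge relation, so that both orientations of every edge
  occur in \<^const>\<open>parcs\<close>.
\<close>

text \<open>
  Maps between vertex sets are taken extensional, so that every map is counted once.
\<close>

definition inj_count :: "'a pair_pre_digraph \<Rightarrow> 'b pair_pre_digraph \<Rightarrow> nat" where
  "inj_count H G =
     card {\<phi> \<in> pverts H \<rightarrow>\<^sub>E pverts G.
             inj_on \<phi> (pverts H) \<and> (\<forall>(x, y) \<in> parcs H. (\<phi> x, \<phi> y) \<in> parcs G)}"

definition clique_free :: "nat \<Rightarrow> 'a pair_pre_digraph \<Rightarrow> bool" where
  "clique_free k G \<longleftrightarrow> \<not> (\<exists>K. subgraph K (with_proj G) \<and> complete_digraph k K)"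

text \<open>
  Turan graphs are specified up to isomorphism, on an arbitrary vertex set; the parts
  \<open>P 0, \<dots>, P (r - 1)\<close> may be empty.
\<close>

definition turan_graph :: "nat \<Rightarrow> nat \<Rightarrow> 'a pair_pre_digraph \<Rightarrow> bool" where
  "turan_graph r n T \<longleftrightarrow>
     pair_graph T \<and> card (pverts T) = n \<and>
     (\<exists>P :: nat \<Rightarrow> 'a set.
        pverts T = (\<Union>i<r. P i) \<and> disjoint_family_on P {..<r} \<and>
        (\<forall>i<r. int (card (P i)) \<in> {\<lfloor>real n / real r\<rfloor>, \<lceil>real n / real r\<rceil>}) \<and>
        parcs T = {(u, v). \<exists>i<r. \<exists>j<r. i \<noteq> j \<and> u \<in> P i \<and> v \<in> P j})"

lemma card_residue_class:
  fixes n r i :: nat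
  assumes "i < r"
  shows "int (card {v. v < n \<and> v mod r = i}) \<in> {\<lfloor>real n / real r\<rfloor>, \<lceil>real n / real r\<rceil>}"
proof -
  define c where "c = (n + (r - 1 - i)) div r"
  have "{v. v < n \<and> v mod r = i} = (\<lambda>q. q * r + i) ` {..<c}"
  proof (intro set_eqI iffI)
    fix v assume "v \<in> {v. v < n \<and> v mod r = i}"
    then have v: "v < n" "v = (v div r) * r + i" by auto
    then have "Suc (v div r) * r \<le> n + (r - 1 - i)" using assms by simp
    then have "Suc (v div r) \<le> c" unfolding c_def using assms
      by (simp add: less_eq_div_iff_mult_less_eq del: mult_Suc)
    then show "v \<in> (\<lambda>q. q * r + i) ` {..<c}" using v(2) by auto
  next
    fix v assume "v \<in> (\<lambda>q. q * r + i) ` {..<c}"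
    then obtain q where q: "q < c" "v = q * r + i" by auto
    then have "Suc q * r \<le> n + (r - 1 - i)" using assms
      unfolding c_def Suc_le_eq[symmetric]
      by (simp add: less_eq_div_iff_mult_less_eq del: mult_Suc)
    then show "v \<in> {v. v < n \<and> v mod r = i}" using q(2) assms by auto
  qed
  moreover have "inj_on (\<lambda>q. q * r + i) {..<c}" using assms by (auto intro: inj_onI)
  ultimately have card: "card {v. v < n \<and> v mod r = i} = c" by (simp add: card_image)
  have "n div r \<le> c" unfolding c_def by (simp add: div_le_mono)
  then have lower: "\<lfloor>real n / real r\<rfloor> \<le> int c" by (simp add: floor_divide_of_nat_eq)
  have "c * r \<le> n + (r - 1 - i)" unfolding c_def by (simp add: div_times_less_eq_dividend)
  then have "c * r < n + r" using assms by simp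
  then have "real c * real r < real n + real r"
    by (metis of_nat_add of_nat_less_iff of_nat_mult)
  then have "real c - 1 < real n / real r" using assms by (simp add: field_simps)
  then have upper: "int c \<le> \<lceil>real n / real r\<rceil>" by linarith
  have "\<lceil>real n / real r\<rceil> \<le> \<lfloor>real n / real r\<rfloor> + 1" by linarith
  with lower upper card show ?thesis by auto
qed

text \<open>The standard model: vertices \<open>0, \<dots>, n - 1\<close>, split by their residue modulo \<open>r\<close>.\<close>

lemma turan_graph_exists:
  fixes r n :: nat
  assumes "0 < r"
  shows "turan_graph r n \<lparr>pverts = {..<n}, parcs = {(u, v). u < n \<and> v < n \<and> u mod r \<noteq> v mod r}\<rparr>"
    (is "turan_graph r n ?T")
proof -
  have sub: "{(u, v). u < n \<and> v < n \<and> u mod r \<noteq> v mod r} \<subseteq> {..<n} \<times> {..<n}" by auto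
  have "pair_graph ?T"
    by unfold_locales
      (auto simp: symmetric_def intro: symI finite_subset[OF sub])
  moreover have "\<exists>P. pverts ?T = (\<Union>i<r. P i) \<and> disjoint_family_on P {..<r} \<and>
        (\<forall>i<r. int (card (P i)) \<in> {\<lfloor>real n / real r\<rfloor>, \<lceil>real n / real r\<rceil>}) \<and>
        parcs ?T = {(u, v). \<exists>i<r. \<exists>j<r. i \<noteq> j \<and> u \<in> P i \<and> v \<in> P j}"
    using assms card_residue_class[of _ r n]
    by (intro exI[of _ "\<lambda>i. {v. v < n \<and> v mod r = i}"])
      (auto simp: disjoint_family_on_def)
  ultimately show ?thesis unfolding turan_graph_def by simp
qed

end

theory Submission
  imports Defs
begin

text \<open>
  Induction on the number \<open>n > r\<close> of vertices. Write \<open>h\<close> for the number of vertices of the pattern and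
  \<open>\<tau> + 1 = \<lceil>n / r\<rceil>\<close>. A vertex of \<open>G\<close> with at least \<open>h \<tau>\<close> non-neighbours lies in at most as many
  copies of the pattern as a vertex from a largest part of the Turan graph, since every edge of the
  pattern has two ends at which such a vertex can spoil it; delete both vertices. Otherwise all
  non-neighbourhoods are small, so any fixed pair of vertices extends in nearly all possible ways.
  Furedi's argument yields an \<open>r\<close>-partition for which \<open>G\<close> lacks at least twice as many
  crossing edges as it has edges inside the parts, so exchanging the latter for the former
  creates more copies than it destroys. In a complete multipartite graph with small parts, moving a
  vertex from a part to one smaller by at least two does not destroy copies either.
\<close>

section \<open>Counting injective homomorphisms\<close>

text \<open>The obstacle is that the extensions of a fixed pair are known only up to a constant: at
  most n^(h-2), and by Bernoulli at least half of that. So each comparison needs a surplus of a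
  factor 2 before extensions are counted. Deletion takes it from the two directions of a pattern
  edge, the partition has it built in, and in a move the maps at risk prescribe one vertex more than
  the maps gained, which is worth a factor of order n. The degree threshold h \<open>\<tau>\<close>
  is dictated by deletion: in the Turan graph the chosen vertex may be the image of any of the h
  pattern vertices, and for each choice a monochromatic edge costs at most \<open>\<tau>\<close>
  n^(h-2) maps. Below the threshold, a greedy step avoids at most h sets of size at most 2h
  \<open>\<tau>\<close>, and Bernoulli with an exponent below h asks for n of order h^3
  \<open>\<tau>\<close>. As n is at least r \<open>\<tau>\<close>, this is where the cube in the
  bound on r comes from.\<close>

definition emb :: "'a set \<Rightarrow> 'a rel \<Rightarrow> 'b set \<Rightarrow> 'b rel \<Rightarrow> ('a \<Rightarrow> 'b) set" where
  "emb W F V E = {\<phi> \<in> W \<rightarrow>\<^sub>E V. inj_on \<phi> W \<and> (\<forall>(x, y) \<in> F. (\<phi> x, \<phi> y) \<in> E)}"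

text \<open>Relations are not confined to the vertex set, which is always given separately.\<close>

definition multipartite :: "('b \<Rightarrow> nat) \<Rightarrow> 'b rel" where
  "multipartite c = {(u, v). c u \<noteq> c v}"

definition color_class :: "'b set \<Rightarrow> ('b \<Rightarrow> nat) \<Rightarrow> nat \<Rightarrow> 'b set" where
  "color_class V c i = {v \<in> V. c v = i}"

lemma finite_emb: "finite W \<Longrightarrow> finite V \<Longrightarrow> finite (emb W F V E)"
  unfolding emb_def by (auto intro: finite_subset[OF _ finite_PiE[of W "\<lambda>_. V"]])

text \<open>Bernoulli's inequality gives (1 - K/n)^j >= 1 - jK/n >= 1/2. The factor 2 is the loss
  that the exchange arguments have to make up for.\<close>

lemma Bernoulli_nat:
  fixes n j K :: nat
  assumes "2 * j * K \<le> n"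
  shows "n ^ j \<le> 2 * (n - K) ^ j"
proof (cases "j = 0 \<or> n = 0")
  case True
  then show ?thesis by (cases "j = 0") auto
next
  case False
  then have jn: "j \<ge> 1" "n > 0" by auto
  have "K \<le> j * K" using jn by simp
  then have Kn: "2 * K \<le> n" using assms by linarith
  have "1 / 2 \<le> 1 + real j * (- (real K / real n))"
    using assms jn by (simp add: field_simps) (metis of_nat_le_iff of_nat_mult of_nat_numeral mult.assoc mult.commute)
  also have "\<dots> \<le> (1 + (- (real K / real n))) ^ j"
    using Kn jn by (intro Bernoulli_inequality) (simp add: field_simps)
  finally have "real n ^ j * (1 / 2) \<le> real n ^ j * (1 + (- (real K / real n))) ^ j"
    by (intro mult_left_mono) auto
  also have "\<dots> = (real n * (1 + (- (real K / real n)))) ^ j"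
    by (simp add: power_mult_distrib)
  also have "real n * (1 + (- (real K / real n))) = real (n - K)"
    using jn Kn by (simp add: field_simps of_nat_diff)
  finally have "real (n ^ j) \<le> real (2 * (n - K) ^ j)" by simp
  then show ?thesis by linarith
qed

section \<open>Extensions of partial maps, bounded from above and from below\<close>

lemma card_extensions_le:
  assumes "finite W" "finite V"
  shows "card {\<phi> \<in> W \<rightarrow>\<^sub>E V. \<forall>x\<in>S. \<phi> x = p x} \<le> card V ^ card (W - S)"
proof -
  have "card {\<phi> \<in> W \<rightarrow>\<^sub>E V. \<forall>x\<in>S. \<phi> x = p x} \<le> card ((W - S) \<rightarrow>\<^sub>E V)"
  proof (rule card_inj_on_le)
    show "inj_on (\<lambda>\<phi>. restrict \<phi> (W - S)) {\<phi> \<in> W \<rightarrow>\<^sub>E V. \<forall>x\<in>S. \<phi> x = p x}"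
    proof (rule inj_onI)
      fix \<phi> \<psi>
      assume a: "\<phi> \<in> {\<phi> \<in> W \<rightarrow>\<^sub>E V. \<forall>x\<in>S. \<phi> x = p x}" "\<psi> \<in> {\<phi> \<in> W \<rightarrow>\<^sub>E V. \<forall>x\<in>S. \<phi> x = p x}"
        and eq: "restrict \<phi> (W - S) = restrict \<psi> (W - S)"
      have "\<phi> x = \<psi> x" if "x \<in> W" for x
        using a that fun_cong[OF eq, of x] by (cases "x \<in> S") auto
      then show "\<phi> = \<psi>" using a by (intro PiE_ext[of _ W "\<lambda>_. V"]) auto
    qed
    show "(\<lambda>\<phi>. restrict \<phi> (W - S)) ` {\<phi> \<in> W \<rightarrow>\<^sub>E V. \<forall>x\<in>S. \<phi> x = p x} \<subseteq> (W - S) \<rightarrow>\<^sub>E V"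
      by (auto simp: PiE_def Pi_def)
    show "finite ((W - S) \<rightarrow>\<^sub>E V)" using assms by (intro finite_PiE) auto
  qed
  also have "\<dots> = card V ^ card (W - S)" using assms by (simp add: card_funcsetE)
  finally show ?thesis .
qed

text \<open>The vertices of \<open>X\<close> are placed one by one: a new one has to avoid the
  \<open>D\<close>-neighbours of at most \<open>N\<close> images, each of which excludes at most
  \<open>\<kappa>\<close> elements of \<open>V0\<close>. Pairs inside \<open>S\<close> are exempt
  from \<open>D\<close>, so that \<open>p\<close> may prescribe one forbidden pair on
  purpose.\<close>

lemma card_ge_greedy_extensions:
  assumes "finite X" "finite S" "finite V" "V0 \<subseteq> V" "S \<inter> X = {}" "p ` S \<subseteq> V" "sym D"
    and deg: "\<And>u. u \<in> V \<Longrightarrow> card {v \<in> V0. (u, v) \<in> D} \<le> \<kappa>"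
    and N: "card (S \<union> X) \<le> N"
  shows "(card V0 - N * \<kappa>) ^ card X \<le> card {\<phi> \<in> (S \<union> X) \<rightarrow>\<^sub>E V. (\<forall>x\<in>S. \<phi> x = p x) \<and>
     (\<forall>x\<in>X. \<phi> x \<in> V0 \<and> (\<forall>y\<in>S \<union> X. y \<noteq> x \<longrightarrow> (\<phi> y, \<phi> x) \<notin> D))}"
  using assms(1,5) N
proof (induction X rule: finite_induct)
  case empty
  have "restrict p S \<in> {\<phi> \<in> S \<rightarrow>\<^sub>E V. \<forall>x\<in>S. \<phi> x = p x}" using assms(6) by auto
  moreover have "finite {\<phi> \<in> S \<rightarrow>\<^sub>E V. \<forall>x\<in>S. \<phi> x = p x}"
    using assms by (intro finite_subset[OF _ finite_PiE[of S "\<lambda>_. V"]]) auto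
  ultimately have "0 < card {\<phi> \<in> S \<rightarrow>\<^sub>E V. \<forall>x\<in>S. \<phi> x = p x}" by (simp only: card_gt_0_iff) blast
  then show ?case by simp
next
  case (insert x X)
  let ?A = "\<lambda>X. {\<phi> \<in> (S \<union> X) \<rightarrow>\<^sub>E V. (\<forall>x\<in>S. \<phi> x = p x) \<and>
     (\<forall>x\<in>X. \<phi> x \<in> V0 \<and> (\<forall>y\<in>S \<union> X. y \<noteq> x \<longrightarrow> (\<phi> y, \<phi> x) \<notin> D))}"
  define av where "av \<phi> = {v \<in> V0. \<forall>y\<in>S \<union> X. (\<phi> y, v) \<notin> D}" for \<phi>
  have x: "x \<notin> S" "x \<notin> X" "S \<inter> X = {}" using insert by auto
  have cardSX: "card (S \<union> X) \<le> N"
    using insert.prems x insert.hyps assms(2) by simp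
  have "finite ((S \<union> insert x X) \<rightarrow>\<^sub>E V)" "finite ((S \<union> X) \<rightarrow>\<^sub>E V)"
    using insert.hyps assms by (auto intro!: finite_PiE)
  then have fin: "finite (?A (insert x X))" "finite (?A X)" by (auto intro: finite_subset[rotated])
  have finV0: "finite V0" using assms finite_subset by blast
  have av: "card V0 - N * \<kappa> \<le> card (av \<phi>)" if "\<phi> \<in> ?A X" for \<phi>
  proof -
    let ?U = "\<Union>y\<in>S \<union> X. {v \<in> V0. (\<phi> y, v) \<in> D}"
    have "card ?U \<le> (\<Sum>y\<in>S \<union> X. card {v \<in> V0. (\<phi> y, v) \<in> D})"
      using insert.hyps assms by (intro card_UN_le) auto
    also have "\<dots> \<le> (\<Sum>y\<in>S \<union> X. \<kappa>)" using that by (intro sum_mono deg) auto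
    also have "\<dots> \<le> N * \<kappa>" using cardSX by simp
    finally have U: "card ?U \<le> N * \<kappa>" .
    have avU: "av \<phi> = V0 - ?U" by (auto simp: av_def)
    have "card V0 - card ?U \<le> card (V0 - ?U)"
      by (rule diff_card_le_card_Diff) (rule finite_subset[OF _ finV0], auto)
    then show ?thesis using U unfolding avU by linarith
  qed
  have "(card V0 - N * \<kappa>) ^ card (insert x X) = (card V0 - N * \<kappa>) ^ card X * (card V0 - N * \<kappa>)"
    using insert.hyps by simp
  also have "\<dots> \<le> card (?A X) * (card V0 - N * \<kappa>)"
    using insert.IH x cardSX by (intro mult_right_mono) auto
  also have "\<dots> = (\<Sum>\<phi>\<in>?A X. card V0 - N * \<kappa>)" by simp
  also have "\<dots> \<le> (\<Sum>\<phi>\<in>?A X. card (av \<phi>))" using av by (intro sum_mono)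
  also have "\<dots> = card (Sigma (?A X) av)"
    using fin(2) finV0 by (intro card_SigmaI[symmetric]) (auto simp: av_def)
  also have "\<dots> \<le> card (?A (insert x X))"
  proof (rule card_inj_on_le[of "\<lambda>(\<phi>, v). \<phi>(x := v)"])
    show "inj_on (\<lambda>(\<phi>, v). \<phi>(x := v)) (Sigma (?A X) av)"
    proof (rule inj_onI, clarify)
      fix \<phi> v \<psi> w
      assume m: "\<phi> \<in> S \<union> X \<rightarrow>\<^sub>E V" "\<psi> \<in> S \<union> X \<rightarrow>\<^sub>E V" and eq: "\<phi>(x := v) = \<psi>(x := w)"
      \<comment> \<open>Both maps are \<open>undefined\<close> at \<open>x\<close>, which lies
        outside their domain, so the update at \<open>x\<close> destroys no information.\<close>
      have "\<phi> y = \<psi> y" for y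
        using fun_cong[OF eq, of y] m x PiE_arb[OF m(1), of x] PiE_arb[OF m(2), of x]
        by (cases "y = x") auto
      moreover have "v = w" using fun_cong[OF eq, of x] by simp
      ultimately show "\<phi> = \<psi> \<and> v = w" by auto
    qed
    show "(\<lambda>(\<phi>, v). \<phi>(x := v)) ` Sigma (?A X) av \<subseteq> ?A (insert x X)"
    proof (clarify, intro conjI ballI impI)
      fix \<phi> v
      assume m: "\<phi> \<in> S \<union> X \<rightarrow>\<^sub>E V" "\<forall>x\<in>S. \<phi> x = p x" "v \<in> av \<phi>"
        and g: "\<forall>x\<in>X. \<phi> x \<in> V0 \<and> (\<forall>y\<in>S \<union> X. y \<noteq> x \<longrightarrow> (\<phi> y, \<phi> x) \<notin> D)"
      \<comment> \<open>The choice of \<open>v\<close> tests \<open>D\<close> in one direction only;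
        symmetry also protects the vertices of \<open>X\<close> placed earlier, for which
        \<open>v\<close> is a new partner.\<close>
      have v: "v \<in> V0" "v \<in> V" "\<And>y. y \<in> S \<union> X \<Longrightarrow> (\<phi> y, v) \<notin> D" "\<And>y. y \<in> S \<union> X \<Longrightarrow> (v, \<phi> y) \<notin> D"
        using m(3) assms(4) \<open>sym D\<close> by (auto simp: av_def dest: symD)
      show "\<phi>(x := v) \<in> S \<union> insert x X \<rightarrow>\<^sub>E V"
        using m(1) v(2) by (auto simp: PiE_def extensional_def)
      show "(\<phi>(x := v)) y = p y" if "y \<in> S" for y using that x m(2) by auto
      show "(\<phi>(x := v)) y \<in> V0" if "y \<in> insert x X" for y using that v(1) g by auto
      show "((\<phi>(x := v)) z, (\<phi>(x := v)) y) \<notin> D"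
        if "y \<in> insert x X" "z \<in> S \<union> insert x X" "z \<noteq> y" for y z
        using that v(3,4) g x by auto
    qed
    show "finite (?A (insert x X))" by (rule fin)
  qed
  finally show ?case .
qed

section \<open>Transport along injections, and splitting at a vertex\<close>

lemma card_emb_mono_bij:
  assumes "finite W" "finite V'" "inj_on g V" "g ` V \<subseteq> V'" "F \<subseteq> W \<times> W"
    and "\<And>u v. u \<in> V \<Longrightarrow> v \<in> V \<Longrightarrow> (u, v) \<in> E \<Longrightarrow> (g u, g v) \<in> E'"
  shows "card (emb W F V E) \<le> card (emb W F V' E')"
proof (rule card_inj_on_le)
  let ?f = "\<lambda>\<phi>. restrict (g \<circ> \<phi>) W"
  show "inj_on ?f (emb W F V E)"
  proof (rule inj_onI)
    fix \<phi> \<psi>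
    assume m: "\<phi> \<in> emb W F V E" "\<psi> \<in> emb W F V E" and eq: "?f \<phi> = ?f \<psi>"
    have "\<phi> x = \<psi> x" if "x \<in> W" for x
      using fun_cong[OF eq, of x] that m inj_onD[OF assms(3)] by (auto simp: emb_def)
    then show "\<phi> = \<psi>" using m by (intro PiE_ext[of _ W "\<lambda>_. V"]) (auto simp: emb_def)
  qed
  show "?f ` emb W F V E \<subseteq> emb W F V' E'"
  proof (rule image_subsetI)
    fix \<phi> assume m: "\<phi> \<in> emb W F V E"
    have "\<phi> ` W \<subseteq> V" "inj_on \<phi> W" using m by (auto simp: emb_def)
    then have "inj_on (g \<circ> \<phi>) W"
      using inj_on_subset[OF assms(3)] by (intro comp_inj_on)
    then have "inj_on (?f \<phi>) W" by (simp add: inj_on_def)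
    moreover have "?f \<phi> \<in> W \<rightarrow>\<^sub>E V'" using m assms(4) by (auto simp: emb_def PiE_def Pi_def)
    moreover have "\<forall>(x, y)\<in>F. (?f \<phi> x, ?f \<phi> y) \<in> E'"
    proof clarify
      fix x y assume that: "(x, y) \<in> F"
      have "x \<in> W" "y \<in> W" using that assms(5) by auto
      then show "(?f \<phi> x, ?f \<phi> y) \<in> E'"
        using m that assms(6)[of "\<phi> x" "\<phi> y"] by (auto simp: emb_def)
    qed
    ultimately show "?f \<phi> \<in> emb W F V' E'" unfolding emb_def by blast
  qed
  show "finite (emb W F V' E')" using assms by (intro finite_emb)
qed

lemma card_injections_eq:
  assumes "finite W" "finite V" "finite V'" "card V = card V'"
  shows "card (emb W {} V E) = card (emb W {} V' E')"
proof -
  obtain g where g: "bij_betw g V V'" using assms finite_same_card_bij by blast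
  then have "bij_betw (inv_into V g) V' V" by (rule bij_betw_inv_into)
  note inv = bij_betw_imp_inj_on[OF this] bij_betw_imp_surj_on[OF this]
  have "card (emb W {} V UNIV) \<le> card (emb W {} V' UNIV)"
    using assms bij_betw_imp_inj_on[OF g] bij_betw_imp_surj_on[OF g]
    by (intro card_emb_mono_bij[where g = g]) simp_all
  moreover have "card (emb W {} V' UNIV) \<le> card (emb W {} V UNIV)"
    using assms inv by (intro card_emb_mono_bij[where g = "inv_into V g"]) simp_all
  ultimately show ?thesis by (simp add: emb_def)
qed

lemma card_emb_split:
  assumes "finite W" "finite V"
  shows "card (emb W F V E) = card (emb W F (V - {v}) E) + card {\<phi> \<in> emb W F V E. v \<in> \<phi> ` W}"
proof -
  have "emb W F V E = emb W F (V - {v}) E \<union> {\<phi> \<in> emb W F V E. v \<in> \<phi> ` W}"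
    by (auto simp: emb_def PiE_def Pi_def)
  moreover have "emb W F (V - {v}) E \<inter> {\<phi> \<in> emb W F V E. v \<in> \<phi> ` W} = {}"
    by (auto simp: emb_def PiE_def Pi_def)
  ultimately show ?thesis using assms
    by (metis (no_types, lifting) card_Un_disjoint finite_Un finite_emb)
qed

text \<open>Deleting the chosen vertices leaves equinumerous sets, so both sides are differences of
  counts that depend on cardinalities alone. This provides the common total in
  \<open>card_emb_through_le\<close>, where the failing maps are compared.\<close>

lemma card_injections_through_eq:
  assumes "finite W" "finite V" "finite V'" "card V = card V'" "v \<in> V" "v' \<in> V'"
  shows "card {\<phi> \<in> emb W {} V E. v \<in> \<phi> ` W} = card {\<phi> \<in> emb W {} V' E'. v' \<in> \<phi> ` W}"
proof -
  have "card (emb W {} V E) = card (emb W {} V' E')"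
    using assms by (intro card_injections_eq)
  moreover have "card (emb W {} (V - {v}) E) = card (emb W {} (V' - {v'}) E')"
    using assms by (intro card_injections_eq) auto
  ultimately show ?thesis
    using card_emb_split[OF assms(1,2), of "{}" E v] card_emb_split[OF assms(1,3), of "{}" E' v'] by linarith
qed

section \<open>Partitions of clique-free graphs\<close>

text \<open>
  Erdos' degree majorisation as used by Furedi: split off the non-neighbourhood of a vertex of
  maximum degree and recurse into its neighbourhood. The sets on both sides consist of ordered pairs.
\<close>

lemma clique_free_partition:
  assumes "finite V" "sym E" "irrefl E"
    and "\<And>K. K \<subseteq> V \<Longrightarrow> card K = r + 1 \<Longrightarrow> \<exists>u\<in>K. \<exists>v\<in>K. u \<noteq> v \<and> (u, v) \<notin> E"
  shows "\<exists>c. c ` V \<subseteq> {..<r} \<and> (\<forall>u\<in>V. \<exists>x\<in>V. color_class V c (c u) \<subseteq> {w \<in> V. (x, w) \<notin> E}) \<and>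
    2 * card {(u, v). u \<in> V \<and> v \<in> V \<and> (u, v) \<in> E \<and> c u = c v}
    \<le> card {(u, v). u \<in> V \<and> v \<in> V \<and> (u, v) \<notin> E \<and> c u \<noteq> (c v :: nat)}"
  using assms(1,4)
proof (induction r arbitrary: V)
  case 0
  have "V = {}"
  proof (rule ccontr)
    assume "V \<noteq> {}"
    then obtain x where "x \<in> V" by auto
    then show False using "0.prems"(2)[of "{x}"] by auto
  qed
  then show ?case by auto
next
  case (Suc r)
  show ?case
  proof (cases "V = {}")
    case True
    then show ?thesis by auto
  next
    case False
    define dg where "dg v = card {w \<in> V. (v, w) \<in> E}" for v
    obtain x where x: "x \<in> V" "\<And>v. v \<in> V \<Longrightarrow> dg v \<le> dg x"
    proof -
      have "Max (dg ` V) \<in> dg ` V" using False Suc.prems(1) by (intro Max_in) auto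
      then obtain x where "x \<in> V" "Max (dg ` V) = dg x" by auto
      then show thesis using Suc.prems(1) by (intro that[of x]) (metis Max_ge finite_imageI imageI)+
    qed
    define V' where "V' = {w \<in> V. (x, w) \<in> E}"
    define X where "X = V - V'"
    have fin: "finite V'" "finite X" using Suc.prems by (auto simp: V'_def X_def)
    have "\<exists>u\<in>K. \<exists>v\<in>K. u \<noteq> v \<and> (u, v) \<notin> E" if K: "K \<subseteq> V'" "card K = r + 1" for K
    proof -
      have "x \<notin> K" using K assms(3) by (auto simp: V'_def irrefl_def)
      moreover have "finite K" using K fin finite_subset by blast
      ultimately have "card (insert x K) = Suc r + 1" using K by simp
      moreover have "insert x K \<subseteq> V" using K x by (auto simp: V'_def)
      ultimately obtain u v where uv: "u \<in> insert x K" "v \<in> insert x K" "u \<noteq> v" "(u, v) \<notin> E"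
        using Suc.prems(2) by blast
      have "(x, w) \<in> E" "(w, x) \<in> E" if "w \<in> K" for w
        using that K assms(2) by (auto simp: V'_def dest: symD)
      then show ?thesis using uv by auto
    qed
    from Suc.IH[OF fin(1) this] obtain c where c: "c ` V' \<subseteq> {..<r}"
      "\<And>u. u \<in> V' \<Longrightarrow> \<exists>y\<in>V'. color_class V' c (c u) \<subseteq> {w \<in> V'. (y, w) \<notin> E}"
      "2 * card {(u, v). u \<in> V' \<and> v \<in> V' \<and> (u, v) \<in> E \<and> c u = c v}
        \<le> card {(u, v). u \<in> V' \<and> v \<in> V' \<and> (u, v) \<notin> E \<and> c u \<noteq> c v}"
      by auto
    \<comment> \<open>The new colour \<open>r\<close> goes to the non-neighbours of
      \<open>x\<close>, among them \<open>x\<close> itself; the colours from the recursion are below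
      \<open>r\<close>.\<close>
    define c' where "c' v = (if v \<in> V' then c v else r)" for v
    let ?I = "{(u, v). u \<in> V \<and> v \<in> V \<and> (u, v) \<in> E \<and> c' u = c' v}"
    let ?M = "{(u, v). u \<in> V \<and> v \<in> V \<and> (u, v) \<notin> E \<and> c' u \<noteq> c' v}"
    let ?Io = "{(u, v). u \<in> V' \<and> v \<in> V' \<and> (u, v) \<in> E \<and> c u = c v}"
    let ?Mo = "{(u, v). u \<in> V' \<and> v \<in> V' \<and> (u, v) \<notin> E \<and> c u \<noteq> c v}"
    let ?IX = "{(u, v). u \<in> X \<and> v \<in> X \<and> (u, v) \<in> E}"
    let ?MX = "{(u, v). u \<in> X \<and> v \<in> V' \<and> (u, v) \<notin> E}"
    have V: "V = V' \<union> X" "V' \<inter> X = {}" by (auto simp: X_def V'_def)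
    have Viff: "w \<in> V \<longleftrightarrow> w \<in> V' \<or> w \<in> X" "w \<in> V' \<Longrightarrow> w \<notin> X" for w using V by auto
    have c'1: "c' u = c u" "c' u < r" if "u \<in> V'" for u using that c(1) by (auto simp: c'_def)
    have c'2: "c' u = r" if "u \<in> X" for u using that by (auto simp: c'_def X_def)
    have same: "u \<in> V \<and> v \<in> V \<and> c' u = c' v \<longleftrightarrow>
        (u \<in> V' \<and> v \<in> V' \<and> c u = c v) \<or> (u \<in> X \<and> v \<in> X)" for u v
      using Viff c'1 c'2 by (metis less_irrefl)
    have diff: "u \<in> V \<and> v \<in> V \<and> c' u \<noteq> c' v \<longleftrightarrow>
        (u \<in> V' \<and> v \<in> V' \<and> c u \<noteq> c v) \<or> (u \<in> X \<and> v \<in> V') \<or> (v \<in> X \<and> u \<in> V')" for u v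
      using Viff c'1 c'2 by (metis less_irrefl)
    have Esym: "(u, v) \<in> E \<longleftrightarrow> (v, u) \<in> E" for u v using assms(2) by (auto dest: symD)
    have I: "?I = ?Io \<union> ?IX" using same by blast
    have M: "?M = ?Mo \<union> (?MX \<union> ?MX\<inverse>)" using diff Esym by blast
    have finP: "finite ?Io" "finite ?IX" "finite ?Mo" "finite ?MX" "finite (?MX\<inverse>)"
      using fin by (auto intro: finite_subset[of _ "V' \<times> V'"] finite_subset[of _ "X \<times> X"]
          finite_subset[of _ "X \<times> V'"] simp del: finite_converse)
    have "card ?I \<le> card ?Io + card ?IX" unfolding I by (rule card_Un_le)
    \<comment> \<open>A new missing pair enters in both orders, while \<open>?IX\<close> already
      holds both orders of each edge inside \<open>X\<close>. Together with
      \<open>card ?IX \<le> card ?MX\<close> this yields the factor 2.\<close>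
    moreover have "card ?M = card ?Mo + 2 * card ?MX"
    proof -
      have "card ?M = card ?Mo + card (?MX \<union> ?MX\<inverse>)"
        unfolding M using finP V(2) by (intro card_Un_disjoint) auto
      also have "card (?MX \<union> ?MX\<inverse>) = card ?MX + card (?MX\<inverse>)"
        using finP V(2) by (intro card_Un_disjoint) auto
      finally show ?thesis by simp
    qed
    moreover have "card ?IX \<le> card ?MX"
    proof -
      have "card ?IX = card (Sigma X (\<lambda>u. {v \<in> X. (u, v) \<in> E}))"
        by (rule arg_cong[of _ _ card]) auto
      also have "\<dots> = (\<Sum>u\<in>X. card {v \<in> X. (u, v) \<in> E})" using fin by simp
      \<comment> \<open>A vertex \<open>u\<close> of \<open>X\<close> has degree at most
        \<open>dg x = card V'\<close>, so it misses at least as many vertices of \<open>V'\<close>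
        as it has neighbours in \<open>X\<close>.\<close>
      also have "\<dots> \<le> (\<Sum>u\<in>X. card {v \<in> V'. (u, v) \<notin> E})"
      proof (rule sum_mono)
        fix u assume "u \<in> X"
        then have "dg u \<le> card V'" using x by (auto simp: X_def dg_def V'_def)
        moreover have "dg u = card {v \<in> X. (u, v) \<in> E} + card {v \<in> V'. (u, v) \<in> E}"
          unfolding dg_def using V fin
          by (subst card_Un_disjoint[symmetric]) (auto intro!: arg_cong[of _ _ card])
        moreover have "card V' = card {v \<in> V'. (u, v) \<notin> E} + card {v \<in> V'. (u, v) \<in> E}"
          using fin by (subst card_Un_disjoint[symmetric]) (auto intro!: arg_cong[of _ _ card])
        ultimately show "card {v \<in> X. (u, v) \<in> E} \<le> card {v \<in> V'. (u, v) \<notin> E}" by linarith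
      qed
      also have "\<dots> = card (Sigma X (\<lambda>u. {v \<in> V'. (u, v) \<notin> E}))" using fin by simp
      also have "\<dots> = card ?MX" by (rule arg_cong[of _ _ card]) auto
      finally show ?thesis .
    qed
    ultimately have "2 * card ?I \<le> card ?M" using c(3) by linarith
    moreover have "c' ` V \<subseteq> {..<Suc r}" using V c'1 c'2 by (auto simp: less_Suc_eq)
    \<comment> \<open>Each class lies inside a single non-neighbourhood, so later a bound on the
      non-neighbourhoods also bounds the classes.\<close>
    moreover have "\<exists>y\<in>V. color_class V c' (c' u) \<subseteq> {w \<in> V. (y, w) \<notin> E}" if "u \<in> V" for u
    proof (cases "u \<in> V'")
      case True
      then obtain y where y: "y \<in> V'" "color_class V' c (c u) \<subseteq> {w \<in> V'. (y, w) \<notin> E}"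
        using c(2) by blast
      have "color_class V c' (c' u) \<subseteq> color_class V' c (c u)"
        using True V c'1 c'2 by (fastforce simp: color_class_def)
      then show ?thesis using y V by blast
    next
      case False
      then have "color_class V c' (c' u) \<subseteq> X"
        using that V c'1 c'2 by (fastforce simp: color_class_def)
      then show ?thesis using x by (intro bexI[of _ x]) (auto simp: X_def V'_def)
    qed
    ultimately show ?thesis by blast
  qed
qed

section \<open>Exchange arguments\<close>

lemma mult_card_le_disjoint:
  assumes "finite I" "finite B" "\<And>i. i \<in> I \<Longrightarrow> A i \<subseteq> B" "\<And>i. i \<in> I \<Longrightarrow> m \<le> card (A i)"
    and "\<And>i j \<phi>. i \<in> I \<Longrightarrow> j \<in> I \<Longrightarrow> \<phi> \<in> A i \<Longrightarrow> \<phi> \<in> A j \<Longrightarrow> i = j"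
  shows "card I * m \<le> card B"
proof -
  have "card I * m = (\<Sum>i\<in>I. m)" by simp
  also have "\<dots> \<le> (\<Sum>i\<in>I. card (A i))" using assms(4) by (rule sum_mono)
  also have "\<dots> = card (\<Union>i\<in>I. A i)"
    using assms(1,2,3,5) by (intro card_UN_disjoint[symmetric]) (blast intro: finite_subset)+
  also have "\<dots> \<le> card B" using assms(2,3) by (intro card_mono) auto
  finally show ?thesis .
qed

lemma card_le_mult_cover:
  assumes "finite I" "\<And>i. i \<in> I \<Longrightarrow> finite (A i)" "B \<subseteq> (\<Union>i\<in>I. A i)" "\<And>i. i \<in> I \<Longrightarrow> card (A i) \<le> m"
  shows "card B \<le> card I * m"
proof -
  have "card B \<le> card (\<Union>i\<in>I. A i)" using assms by (intro card_mono) auto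
  also have "\<dots> \<le> (\<Sum>i\<in>I. card (A i))" using assms(1) by (rule card_UN_le)
  also have "\<dots> \<le> (\<Sum>i\<in>I. m)" using assms(4) by (rule sum_mono)
  finally show ?thesis by simp
qed

text \<open>Everything but \<open>y\<close> is placed first, with the image of \<open>z\<close>
  fixed, and \<open>y\<close> then goes into the class of the image of \<open>x\<close>. Injectivity
  excludes that image itself, which turns \<open>\<tau> + 1\<close> into \<open>\<tau>\<close>; the
  balance of constants in \<open>card_emb_through_le\<close> relies on this.\<close>

lemma card_monochromatic_le:
  assumes "finite W" "finite V" "x \<in> W" "y \<in> W" "z \<in> W" "x \<noteq> y" "w \<in> V"
    and "\<And>u. u \<in> V \<Longrightarrow> card (color_class V c (c u)) \<le> \<tau> + 1"
  shows "card {\<phi> \<in> emb W {} V UNIV. \<phi> z = w \<and> c (\<phi> x) = c (\<phi> y)} \<le> card V ^ (card W - 2) * \<tau>"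
proof -
  \<comment> \<open>The vertex placed last must not be \<open>z\<close>. As \<open>x\<close> and
    \<open>y\<close> are distinct and play symmetric roles, one of them qualifies.\<close>
  have *: "card {\<phi> \<in> emb W {} V UNIV. \<phi> z = w \<and> c (\<phi> x) = c (\<phi> y)} \<le> card V ^ (card W - 2) * \<tau>"
    if xy: "x \<in> W" "y \<in> W" "x \<noteq> y" "z \<noteq> y" for x y
  proof -
    let ?P = "{\<psi> \<in> (W - {y}) \<rightarrow>\<^sub>E V. \<forall>a\<in>{z}. \<psi> a = w}"
    let ?A = "\<lambda>\<psi>. (\<lambda>u. \<psi>(y := u)) ` (color_class V c (c (\<psi> x)) - {\<psi> x})"
    have finP: "finite ?P" using assms by (intro finite_subset[OF _ finite_PiE[of "W - {y}" "\<lambda>_. V"]]) auto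
    have "card {\<phi> \<in> emb W {} V UNIV. \<phi> z = w \<and> c (\<phi> x) = c (\<phi> y)} \<le> card ?P * \<tau>"
    proof (rule card_le_mult_cover[OF finP, where A = ?A])
      show "finite (?A \<psi>)" for \<psi> using assms by (auto simp: color_class_def)
      show "card (?A \<psi>) \<le> \<tau>" if "\<psi> \<in> ?P" for \<psi>
      proof -
        have x: "\<psi> x \<in> V" using that xy by auto
        have "card (?A \<psi>) \<le> card (color_class V c (c (\<psi> x)) - {\<psi> x})"
          using assms by (intro card_image_le) (auto simp: color_class_def)
        also have "\<dots> = card (color_class V c (c (\<psi> x))) - 1"
          using x assms(2) by (subst card_Diff_singleton) (auto simp: color_class_def)
        also have "\<dots> \<le> \<tau>" using assms(8)[OF x] by linarith
        finally show ?thesis .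
      qed
      show "{\<phi> \<in> emb W {} V UNIV. \<phi> z = w \<and> c (\<phi> x) = c (\<phi> y)} \<subseteq> (\<Union>\<psi>\<in>?P. ?A \<psi>)"
      proof
        fix \<phi> assume "\<phi> \<in> {\<phi> \<in> emb W {} V UNIV. \<phi> z = w \<and> c (\<phi> x) = c (\<phi> y)}"
        then have \<phi>: "\<phi> \<in> W \<rightarrow>\<^sub>E V" "inj_on \<phi> W" "\<phi> z = w" "c (\<phi> x) = c (\<phi> y)" by (auto simp: emb_def)
        have "restrict \<phi> (W - {y}) \<in> ?P" using \<phi> xy assms(5) by (auto simp: PiE_def Pi_def)
        moreover have "\<phi> = (restrict \<phi> (W - {y}))(y := \<phi> y)"
          using \<phi>(1) xy by (auto simp: fun_eq_iff PiE_def extensional_def)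
        moreover have "\<phi> y \<in> color_class V c (c (restrict \<phi> (W - {y}) x)) - {restrict \<phi> (W - {y}) x}"
          using \<phi> xy by (auto simp: color_class_def inj_on_def)
        ultimately show "\<phi> \<in> (\<Union>\<psi>\<in>?P. ?A \<psi>)" by blast
      qed
    qed
    also have "card ?P \<le> card V ^ card (W - {y} - {z})" using assms by (intro card_extensions_le) auto
    also have "card (W - {y} - {z}) = card W - 2" using xy assms by (simp add: card_Diff_singleton)
    finally show ?thesis by simp
  qed
  show ?thesis
  proof (cases "z = y")
    case True
    have "{\<phi> \<in> emb W {} V UNIV. \<phi> z = w \<and> c (\<phi> x) = c (\<phi> y)}
      = {\<phi> \<in> emb W {} V UNIV. \<phi> z = w \<and> c (\<phi> y) = c (\<phi> x)}" by auto
    then show ?thesis using *[of y x] assms True by simp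
  next
    case False
    then show ?thesis using *[of x y] assms by simp
  qed
qed

text \<open>With one direction per edge, \<open>card F\<close> counts edges and a map that spoils
  exactly one edge belongs to exactly one element of \<open>F\<close>. With both directions every
  such map would be indexed twice.\<close>

locale pattern =
  fixes W :: "'a set" and F :: "'a rel"
  assumes finite_W: "finite W" and F_subset: "F \<subseteq> W \<times> W"
    and asym_F: "(x, y) \<in> F \<Longrightarrow> (y, x) \<notin> F"
begin

lemma finite_F: "finite F"
  using F_subset finite_W by (meson finite_SigmaI finite_subset)

lemma F_neq: "(x, y) \<in> F \<Longrightarrow> x \<noteq> y"
  using asym_F by blast

lemma card_F_sym: "card (F \<union> F\<inverse>) = 2 * card F"
proof -
  have "card (F \<union> F\<inverse>) = card F + card (F\<inverse>)"
    using finite_F asym_F by (intro card_Un_disjoint) auto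
  then show ?thesis by simp
qed

text \<open>Both graphs admit equally many injections through the chosen vertex, so it suffices to
  compare those that fail. With h for \<open>card W\<close>, a failure in the multipartite graph has
  a monochromatic edge and one of h preimages of \<open>w\<close>: at most
  \<open>card F * card W * \<tau>\<close> times n^(h-2) maps. At \<open>v\<close>, each directed
  edge of the pattern and each of h \<open>\<tau>\<close> non-neighbours produce at least half of
  n^(h-2) failures.\<close>

lemma card_emb_through_le:
  assumes fin: "finite V" "finite V'" and n: "card V = n" "card V' = n" and vw: "v \<in> V" "w \<in> V'"
    and "sym E" and deg: "card W * \<tau> \<le> card {u \<in> V. u \<noteq> v \<and> (v, u) \<notin> E}"
    and cls: "\<And>u. u \<in> V' \<Longrightarrow> card (color_class V' c (c u)) \<le> \<tau> + 1"
    and large: "2 * card W * (card W * \<tau> + card W) \<le> n"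
  shows "card {\<phi> \<in> emb W F V E. v \<in> \<phi> ` W} \<le> card {\<phi> \<in> emb W F V' (multipartite c). w \<in> \<phi> ` W}"
proof -
  let ?h = "card W"
  let ?J = "{\<phi> \<in> emb W {} V UNIV. v \<in> \<phi> ` W}" and ?J' = "{\<phi> \<in> emb W {} V' UNIV. w \<in> \<phi> ` W}"
  let ?G = "{\<phi> \<in> emb W F V E. v \<in> \<phi> ` W}" and ?G' = "{\<phi> \<in> emb W F V' (multipartite c). w \<in> \<phi> ` W}"
  have finJ: "finite ?J" "finite ?J'" using fin finite_W by (auto intro: finite_subset[OF _ finite_emb])
  have sub: "?G \<subseteq> ?J" "?G' \<subseteq> ?J'" by (auto simp: emb_def)
  have J: "card ?J = card ?J'" using fin finite_W n vw by (intro card_injections_through_eq) auto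
  \<comment> \<open>Exactly \<open>?h * \<tau>\<close> non-neighbours are taken, so that
    \<open>Q\<close> is small enough for the free vertices to avoid.\<close>
  obtain Q where Q: "Q \<subseteq> {u \<in> V. u \<noteq> v \<and> (v, u) \<notin> E}" "card Q = ?h * \<tau>" "finite Q"
    using obtain_subset_with_card_n[OF deg] by metis
  have upper: "card (?J' - ?G') \<le> card (F \<times> W) * (n ^ (?h - 2) * \<tau>)"
  proof (rule card_le_mult_cover)
    let ?A = "\<lambda>((x, y), z). {\<phi> \<in> emb W {} V' UNIV. \<phi> z = w \<and> c (\<phi> x) = c (\<phi> y)}"
    show "finite (F \<times> W)" using finite_F finite_W by simp
    show "finite (?A i)" for i using fin finite_W by (auto intro: finite_subset[OF _ finite_emb] split: prod.splits)
    show "?J' - ?G' \<subseteq> (\<Union>i\<in>F \<times> W. ?A i)"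
      by (fastforce simp: emb_def multipartite_def)
    show "card (?A i) \<le> n ^ (?h - 2) * \<tau>" if "i \<in> F \<times> W" for i
    proof -
      obtain x y z where i: "i = ((x, y), z)" by (metis surj_pair)
      then have "x \<in> W" "y \<in> W" "z \<in> W" "x \<noteq> y" using that F_subset F_neq by auto
      then show ?thesis using card_monochromatic_le[of W V' x y z w c \<tau>] fin finite_W vw cls n i by simp
    qed
  qed
  have lower: "card ((F \<union> F\<inverse>) \<times> Q) * (n - (?h * \<tau> + ?h)) ^ (?h - 2) \<le> card (?J - ?G)"
  proof (rule mult_card_le_disjoint)
    \<comment> \<open>All vertices except \<open>y\<close> stay outside \<open>Q\<close>, so the map
      determines its index: \<open>x\<close> is the preimage of \<open>v\<close>, and
      \<open>y\<close> is the only vertex sent into \<open>Q\<close>. With \<open>Id\<close> as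
      forbidden relation the greedy count asks only for distinct images.\<close>
    let ?p = "\<lambda>x u a. if a = x then v else u"
    let ?A = "\<lambda>((x, y), u). {\<phi> \<in> ({x, y} \<union> (W - {x, y})) \<rightarrow>\<^sub>E V. (\<forall>a\<in>{x, y}. \<phi> a = ?p x u a) \<and>
      (\<forall>a\<in>W - {x, y}. \<phi> a \<in> V - Q \<and> (\<forall>b\<in>{x, y} \<union> (W - {x, y}). b \<noteq> a \<longrightarrow> (\<phi> b, \<phi> a) \<notin> Id))}"
    have A: "\<phi> \<in> W \<rightarrow>\<^sub>E V" "inj_on \<phi> W" "x \<in> W" "y \<in> W" "x \<noteq> y" "\<phi> x = v" "\<phi> y = u" "(v, u) \<notin> E" "u \<in> Q"
      "\<And>a. a \<in> W \<Longrightarrow> \<phi> a \<in> Q \<Longrightarrow> a = y"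
      if i: "((x, y), u) \<in> (F \<union> F\<inverse>) \<times> Q" and \<phi>: "\<phi> \<in> ?A ((x, y), u)" for x y u \<phi>
    proof -
      show xy: "x \<in> W" "y \<in> W" "x \<noteq> y" using i F_subset F_neq by auto
      then have eq: "{x, y} \<union> (W - {x, y}) = W" by auto
      show "\<phi> \<in> W \<rightarrow>\<^sub>E V" using \<phi> eq by auto
      show vals: "\<phi> x = v" "\<phi> y = u" using \<phi> xy by auto
      show u: "(v, u) \<notin> E" "u \<in> Q" using i Q by auto
      have vu: "u \<noteq> v" "v \<notin> Q" using i Q by auto
      have other: "\<phi> a \<notin> Q" "b \<in> W \<Longrightarrow> b \<noteq> a \<Longrightarrow> \<phi> b \<noteq> \<phi> a" if "a \<in> W" "a \<noteq> x" "a \<noteq> y" for a b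
        using \<phi> that eq by auto
      show "inj_on \<phi> W"
      proof (rule inj_onI)
        fix a b assume ab: "a \<in> W" "b \<in> W" "\<phi> a = \<phi> b"
        then show "a = b" using other(2)[of a b] other(2)[of b a] vals vu by metis
      qed
      show "a = y" if "a \<in> W" "\<phi> a \<in> Q" for a using that other(1)[of a] vals vu by metis
    qed
    show "finite ((F \<union> F\<inverse>) \<times> Q)" using finite_F Q by simp
    show "finite (?J - ?G)" using finJ by simp
    show "?A i \<subseteq> ?J - ?G" if "i \<in> (F \<union> F\<inverse>) \<times> Q" for i
    proof
      fix \<phi> assume "\<phi> \<in> ?A i"
      obtain x y u where i: "i = ((x, y), u)" by (metis surj_pair)
      note a = A[OF that[unfolded i] \<open>\<phi> \<in> ?A i\<close>[unfolded i]]
      have "(x, y) \<in> F \<or> (y, x) \<in> F" using that i by auto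
      moreover have "(u, v) \<notin> E" using a(8) \<open>sym E\<close> by (auto dest: symD)
      ultimately have "\<phi> \<notin> emb W F V E" using a(6,7,8) by (auto simp: emb_def)
      moreover have "v \<in> \<phi> ` W" using a(3,6) by blast
      ultimately show "\<phi> \<in> ?J - ?G" using a(1,2) by (auto simp: emb_def)
    qed
    show "(n - (?h * \<tau> + ?h)) ^ (?h - 2) \<le> card (?A i)" if "i \<in> (F \<union> F\<inverse>) \<times> Q" for i
    proof -
      obtain x y u where i: "i = ((x, y), u)" by (metis surj_pair)
      then have xy: "x \<in> W" "y \<in> W" "x \<noteq> y" and u: "u \<in> V" using that F_subset F_neq Q by auto
      have "(card (V - Q) - ?h * 1) ^ card (W - {x, y}) \<le> card (?A i)"
        unfolding i prod.case using fin finite_W vw u xy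
      proof (intro card_ge_greedy_extensions)
        show "card {w \<in> V - Q. (a, w) \<in> Id} \<le> 1" for a
          by (rule order.trans[OF card_mono[of "{a}"]]) auto
        show "card ({x, y} \<union> (W - {x, y})) \<le> ?h" using xy finite_W by (intro card_mono) auto
      qed (auto intro: sym_Id)
      moreover have "card (V - Q) = n - ?h * \<tau>" using Q n by (subst card_Diff_subset) auto
      moreover have "card (W - {x, y}) = ?h - 2" using xy finite_W by (subst card_Diff_subset) auto
      ultimately show ?thesis by (simp add: diff_diff_left)
    qed
    show "i = j" if ij: "i \<in> (F \<union> F\<inverse>) \<times> Q" "j \<in> (F \<union> F\<inverse>) \<times> Q" "\<phi> \<in> ?A i" "\<phi> \<in> ?A j" for i j \<phi>
    proof -
      obtain x y u where i: "i = ((x, y), u)" by (metis surj_pair)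
      obtain x' y' u' where j: "j = ((x', y'), u')" by (metis surj_pair)
      note a = A[OF ij(1)[unfolded i] ij(3)[unfolded i]] and b = A[OF ij(2)[unfolded j] ij(4)[unfolded j]]
      have "x = x'" using a(2,3,6) b(3,6) by (auto dest: inj_onD)
      moreover have "y = y'" using a(10) b(4,7,9) by simp
      ultimately show ?thesis using i j a(7) b(7) by simp
    qed
  qed
  have "card (F \<times> W) * (n ^ (?h - 2) * \<tau>) \<le> card (F \<times> W) * (2 * (n - (?h * \<tau> + ?h)) ^ (?h - 2) * \<tau>)"
  proof (intro mult_left_mono mult_right_mono Bernoulli_nat)
    have "2 * (?h - 2) * (?h * \<tau> + ?h) \<le> 2 * ?h * (?h * \<tau> + ?h)" by (intro mult_right_mono) auto
    then show "2 * (?h - 2) * (?h * \<tau> + ?h) \<le> n" using large by linarith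
  qed auto
  \<comment> \<open>The two directions of an edge absorb the 2 from Bernoulli; \<open>card Q\<close>
    absorbs both the choice of the preimage of \<open>w\<close> and the factor
    \<open>\<tau>\<close>.\<close>
  also have "\<dots> = card ((F \<union> F\<inverse>) \<times> Q) * (n - (?h * \<tau> + ?h)) ^ (?h - 2)"
    using Q(2) by (simp add: card_F_sym card_cartesian_product)
  finally have "card (?J' - ?G') \<le> card (?J - ?G)" using upper lower by linarith
  moreover have "card (?J - ?G) = card ?J - card ?G" "card ?G \<le> card ?J"
    using finJ sub by (auto intro!: card_Diff_subset card_mono intro: finite_subset)
  moreover have "card (?J' - ?G') = card ?J' - card ?G'" "card ?G' \<le> card ?J'"
    using finJ sub by (auto intro!: card_Diff_subset card_mono intro: finite_subset)
  ultimately show ?thesis using J by linarith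
qed

text \<open>A map lost by the exchange sends some edge to a pair in \<open>?I\<close>; gained maps
  arise from any edge and any pair in \<open>?M\<close> by greedy extension. The factor 2 in
  \<open>part\<close> offsets the one from Bernoulli. The bound \<open>2 * \<kappa>\<close> appears
  because a free vertex avoids both the non-neighbours and the class of every other image.\<close>

lemma card_emb_le_multipartite:
  assumes fin: "finite V" and n: "card V = n" and "sym E"
    and part: "2 * card {(u, v). u \<in> V \<and> v \<in> V \<and> (u, v) \<in> E \<and> c u = c v}
      \<le> card {(u, v). u \<in> V \<and> v \<in> V \<and> (u, v) \<notin> E \<and> c u \<noteq> c v}"
    and deg: "\<And>v. v \<in> V \<Longrightarrow> card {w \<in> V. (v, w) \<notin> E} \<le> \<kappa>"
    and cls: "\<And>v. v \<in> V \<Longrightarrow> card (color_class V c (c v)) \<le> \<kappa>"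
    and large: "2 * card W * (card W * (2 * \<kappa>)) \<le> n"
  shows "card (emb W F V E) \<le> card (emb W F V (multipartite c))"
proof -
  let ?h = "card W"
  let ?I = "{(u, v). u \<in> V \<and> v \<in> V \<and> (u, v) \<in> E \<and> c u = c v}"
  let ?M = "{(u, v). u \<in> V \<and> v \<in> V \<and> (u, v) \<notin> E \<and> c u \<noteq> c v}"
  let ?G = "emb W F V E" and ?K = "emb W F V (multipartite c)"
  let ?p = "\<lambda>x u v a. if a = x then u else v"
  have finGK: "finite ?G" "finite ?K" using fin finite_W by (auto intro: finite_emb)
  have finIM: "finite ?I" "finite ?M" using fin by (auto intro: finite_subset[of _ "V \<times> V"])
  have card2: "card (W - {x, y}) = ?h - 2" if "(x, y) \<in> F" for x y
    using that F_subset F_neq finite_W by (subst card_Diff_subset) auto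
  have upper: "card (?G - ?K) \<le> card (F \<times> ?I) * n ^ (?h - 2)"
  proof (rule card_le_mult_cover)
    let ?A = "\<lambda>((x, y), (u, v)). {\<phi> \<in> W \<rightarrow>\<^sub>E V. \<forall>a\<in>{x, y}. \<phi> a = ?p x u v a}"
    show "finite (F \<times> ?I)" using finite_F finIM by simp
    show "finite (?A i)" for i
      using fin finite_W by (auto intro!: finite_subset[OF _ finite_PiE[of W "\<lambda>_. V"]] split: prod.splits)
    show "?G - ?K \<subseteq> (\<Union>i\<in>F \<times> ?I. ?A i)"
    proof
      fix \<phi> assume \<phi>: "\<phi> \<in> ?G - ?K"
      then obtain x y where xy: "(x, y) \<in> F" "c (\<phi> x) = c (\<phi> y)"
        by (auto simp: emb_def multipartite_def)
      then have "((x, y), (\<phi> x, \<phi> y)) \<in> F \<times> ?I" "\<phi> \<in> ?A ((x, y), (\<phi> x, \<phi> y))"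
        using \<phi> F_subset by (auto simp: emb_def)
      then show "\<phi> \<in> (\<Union>i\<in>F \<times> ?I. ?A i)" by blast
    qed
    show "card (?A i) \<le> n ^ (?h - 2)" if "i \<in> F \<times> ?I" for i
    proof -
      obtain x y u v where i: "i = ((x, y), (u, v))" by (metis surj_pair)
      then show ?thesis
        using card_extensions_le[OF finite_W fin, of "{x, y}" "?p x u v"] card2[of x y] that n by simp
    qed
  qed
  txt \<open>Keeping all other pairs outside \<open>D\<close> ensures that each counted map sends exactly one
    edge to a missing pair, so that no map is counted twice.\<close>
  define D where "D = {(u, v). (u, v) \<notin> E \<or> c u = c v}"
  have "sym D" using \<open>sym E\<close> by (auto simp: D_def sym_def)
  have lower: "card (F \<times> ?M) * (n - ?h * (2 * \<kappa>)) ^ (?h - 2) \<le> card (?K - ?G)"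
  proof (rule mult_card_le_disjoint)
    let ?A = "\<lambda>((x, y), (u, v)). {\<phi> \<in> ({x, y} \<union> (W - {x, y})) \<rightarrow>\<^sub>E V. (\<forall>a\<in>{x, y}. \<phi> a = ?p x u v a) \<and>
      (\<forall>a\<in>W - {x, y}. \<phi> a \<in> V \<and> (\<forall>b\<in>{x, y} \<union> (W - {x, y}). b \<noteq> a \<longrightarrow> (\<phi> b, \<phi> a) \<notin> D))}"
    have A: "\<phi> \<in> ?K" "\<phi> x = u" "\<phi> y = v" "\<phi> \<notin> ?G"
      "\<And>a b. (a, b) \<in> F \<Longrightarrow> (\<phi> a, \<phi> b) \<notin> E \<Longrightarrow> a = x \<and> b = y"
      if i: "((x, y), (u, v)) \<in> F \<times> ?M" and \<phi>: "\<phi> \<in> ?A ((x, y), (u, v))" for x y u v \<phi>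
    proof -
      have xy: "x \<in> W" "y \<in> W" "x \<noteq> y" using i F_subset F_neq by auto
      then have eq: "{x, y} \<union> (W - {x, y}) = W" by auto
      have 1: "\<phi> \<in> W \<rightarrow>\<^sub>E V" using \<phi> eq by auto
      show vals: "\<phi> x = u" "\<phi> y = v" using \<phi> xy by auto
      have uv: "(u, v) \<notin> E" "c u \<noteq> c v" using i by auto
      have other: "(\<phi> b, \<phi> a) \<notin> D" "(\<phi> a, \<phi> b) \<notin> D" if "a \<in> W" "a \<noteq> x" "a \<noteq> y" "b \<in> W" "b \<noteq> a" for a b
        using \<phi> that eq \<open>sym D\<close> by (auto dest: symD)
      \<comment> \<open>\<open>D\<close> contains all pairs within a class, including the diagonal,
        so the images lie in pairwise different classes; for \<open>x\<close> and \<open>y\<close>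
        this holds because \<open>(u, v)\<close> is a crossing pair.\<close>
      have diff: "c (\<phi> a) \<noteq> c (\<phi> b)" if "a \<in> W" "b \<in> W" "a \<noteq> b" for a b
        using other[of a b] other[of b a] that vals uv by (fastforce simp: D_def)
      then have 2: "inj_on \<phi> W" by (intro inj_onI) metis
      have "c (\<phi> a) \<noteq> c (\<phi> b)" if "(a, b) \<in> F" for a b using diff F_subset F_neq that by blast
      with 1 2 show "\<phi> \<in> ?K" by (auto simp: emb_def multipartite_def)
      show "\<phi> \<notin> ?G" using i vals uv by (auto simp: emb_def)
      show "a = x \<and> b = y" if ab: "(a, b) \<in> F" "(\<phi> a, \<phi> b) \<notin> E" for a b
      proof -
        have m: "a \<in> W" "b \<in> W" "a \<noteq> b" "(y, x) \<noteq> (a, b)" using ab F_subset F_neq asym_F i by auto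
        show ?thesis using other[of a b] other[of b a] m ab by (auto simp: D_def)
      qed
    qed
    show "finite (F \<times> ?M)" using finite_F finIM by simp
    show "finite (?K - ?G)" using finGK by simp
    show "?A i \<subseteq> ?K - ?G" if "i \<in> F \<times> ?M" for i
    proof
      fix \<phi> assume "\<phi> \<in> ?A i"
      obtain x y u v where i: "i = ((x, y), (u, v))" by (metis surj_pair)
      show "\<phi> \<in> ?K - ?G" using A(1,4)[OF that[unfolded i] \<open>\<phi> \<in> ?A i\<close>[unfolded i]] by blast
    qed
    show "(n - ?h * (2 * \<kappa>)) ^ (?h - 2) \<le> card (?A i)" if "i \<in> F \<times> ?M" for i
    proof -
      obtain x y u v where i: "i = ((x, y), (u, v))" by (metis surj_pair)
      then have xy: "(x, y) \<in> F" "x \<in> W" "y \<in> W" "x \<noteq> y" and u: "u \<in> V" "v \<in> V"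
        using that F_subset F_neq by auto
      have "(card V - ?h * (2 * \<kappa>)) ^ card (W - {x, y}) \<le> card (?A i)"
        unfolding i prod.case using fin finite_W u xy \<open>sym D\<close>
      proof (intro card_ge_greedy_extensions)
        show "card {w \<in> V. (a, w) \<in> D} \<le> 2 * \<kappa>" if "a \<in> V" for a
        proof -
          have "{w \<in> V. (a, w) \<in> D} = {w \<in> V. (a, w) \<notin> E} \<union> color_class V c (c a)"
            by (auto simp: D_def color_class_def)
          then have "card {w \<in> V. (a, w) \<in> D} \<le> card {w \<in> V. (a, w) \<notin> E} + card (color_class V c (c a))"
            by (metis card_Un_le)
          then show ?thesis using deg[OF that] cls[OF that] by linarith
        qed
        show "card ({x, y} \<union> (W - {x, y})) \<le> ?h" using xy finite_W by (intro card_mono) auto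
      qed auto
      then show ?thesis using card2[OF xy(1)] n by simp
    qed
    show "i = j" if ij: "i \<in> F \<times> ?M" "j \<in> F \<times> ?M" "\<phi> \<in> ?A i" "\<phi> \<in> ?A j" for i j \<phi>
    proof -
      obtain x y u v where i: "i = ((x, y), (u, v))" by (metis surj_pair)
      obtain x' y' u' v' where j: "j = ((x', y'), (u', v'))" by (metis surj_pair)
      note a = A[OF ij(1)[unfolded i] ij(3)[unfolded i]] and b = A[OF ij(2)[unfolded j] ij(4)[unfolded j]]
      have "(x', y') \<in> F" "(\<phi> x', \<phi> y') \<notin> E" using ij(2) j b(2,3) by auto
      then have "x' = x \<and> y' = y" by (rule a(5))
      then show ?thesis using i j a(2,3) b(2,3) by simp
    qed
  qed
  have "card (?G - ?K) \<le> card (F \<times> ?I) * (2 * (n - ?h * (2 * \<kappa>)) ^ (?h - 2))"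
  proof (rule order.trans[OF upper], intro mult_left_mono Bernoulli_nat)
    have "2 * (?h - 2) * (?h * (2 * \<kappa>)) \<le> 2 * ?h * (?h * (2 * \<kappa>))" by (intro mult_right_mono) auto
    then show "2 * (?h - 2) * (?h * (2 * \<kappa>)) \<le> n" using large by linarith
  qed auto
  also have "\<dots> = card F * (n - ?h * (2 * \<kappa>)) ^ (?h - 2) * (2 * card ?I)"
    by (simp add: card_cartesian_product)
  also have "\<dots> \<le> card F * (n - ?h * (2 * \<kappa>)) ^ (?h - 2) * card ?M" using part by (rule mult_left_mono) simp
  also have "\<dots> \<le> card (?K - ?G)" using lower by (simp add: card_cartesian_product mult_ac)
  finally have "card (?G - ?K) \<le> card (?K - ?G)" .
  moreover have "card ?G = card (?G - ?K) + card (?G \<inter> ?K)"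
    using finGK by (subst card_Un_disjoint[symmetric]) (auto intro!: arg_cong[of _ _ card])
  moreover have "card ?K = card (?K - ?G) + card (?G \<inter> ?K)"
    using finGK by (subst card_Un_disjoint[symmetric]) (auto intro!: arg_cong[of _ _ card])
  ultimately show ?thesis by linarith
qed

text \<open>Only maps through \<open>v\<close> are affected. Fix the preimage \<open>x\<close> of
  \<open>v\<close> and take a map that respects all edges away from \<open>x\<close>: before the
  move it fails iff a neighbour of \<open>x\<close> lands in the rest \<open>A\<close> of the old
  class, afterwards iff one lands in the new class \<open>B\<close>. As \<open>A\<close> is larger
  than \<open>B\<close>, the first failure is at least as frequent.\<close>

lemma card_emb_le_move:
  assumes fin: "finite V" and n: "card V = n" and v: "v \<in> V" and "c v \<noteq> j"
    and unbal: "card (color_class V c j) + 2 \<le> card (color_class V c (c v))"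
    and cls: "\<And>i. card (color_class V c i) \<le> \<kappa>"
    and large: "2 * card W * (card W * \<kappa>) \<le> n"
  shows "card (emb W F V (multipartite c)) \<le> card (emb W F V (multipartite (c(v := j))))"
proof -
  let ?h = "card W" and ?i = "c v" and ?c' = "c(v := j)"
  define B where "B = color_class V c j"
  define A where "A = color_class V c ?i - {v}"
  have cardA: "card A = card (color_class V c ?i) - 1" and finAB: "finite A" "finite B"
    using v fin by (auto simp: A_def B_def color_class_def)
  \<comment> \<open>Leaving out \<open>v\<close> reduces the gap of two to a gap of one, which still
    makes \<open>C\<close> nonempty.\<close>
  then have BA: "card B + 1 \<le> card A" using unbal by (simp add: B_def)
  obtain B' where B': "B' \<subseteq> A" "card B' = card B" "finite B'"
    using obtain_subset_with_card_n[of "card B" A] BA by (metis add_leD1)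
  define C where "C = A - B'"
  have "card C = card A - card B" using B' by (simp add: C_def card_Diff_subset)
  then have C: "card C \<ge> 1" "finite C" using BA finAB by (auto simp: C_def)
  have disj: "v \<notin> A" "v \<notin> B" "A \<inter> B = {}" "A \<subseteq> V" "B \<subseteq> V" "B' \<subseteq> V" "C \<subseteq> V" "C \<subseteq> A" "B' \<inter> C = {}" "B \<inter> C = {}" "B \<inter> B' = {}" "v \<notin> B'" "v \<notin> C"
    using \<open>c v \<noteq> j\<close> B' by (auto simp: A_def B_def C_def color_class_def)
  txt \<open>Swapping \<open>B\<close> and \<open>B'\<close> matches the maps that avoid \<open>C\<close>, which leaves only a comparison
    of the maps that meet \<open>C\<close>.\<close>
  obtain g where g: "bij_betw g B B'" using finAB B' finite_same_card_bij by metis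
  define \<sigma> where "\<sigma> u = (if u \<in> B then g u else if u \<in> B' then inv_into B g u else u)" for u
  have \<sigma>B: "\<sigma> u \<in> B'" if "u \<in> B" for u using that g by (auto simp: \<sigma>_def bij_betw_def)
  have \<sigma>B': "\<sigma> u \<in> B" if "u \<in> B'" for u
    using that g disj bij_betw_inv_into[OF g] by (auto simp: \<sigma>_def bij_betw_def)
  have \<sigma>id: "\<sigma> u = u" if "u \<notin> B" "u \<notin> B'" for u using that by (simp add: \<sigma>_def)
  have invol: "\<sigma> (\<sigma> u) = u" for u
  proof -
    consider "u \<in> B" | "u \<in> B'" | "u \<notin> B" "u \<notin> B'" by blast
    then show ?thesis
    proof cases
      case 1
      then have "\<sigma> u \<notin> B" "\<sigma> u \<in> B'" using \<sigma>B disj by auto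
      then show ?thesis using 1 g by (simp add: \<sigma>_def bij_betw_inv_into_left)
    next
      case 2
      then have "u \<notin> B" "\<sigma> u \<in> B" using \<sigma>B' disj by auto
      then show ?thesis using 2 g by (simp add: \<sigma>_def bij_betw_inv_into_right)
    qed (simp add: \<sigma>id)
  qed
  then have inj\<sigma>: "inj \<sigma>" by (metis injI)
  have \<sigma>V: "\<sigma> u \<in> V" if "u \<in> V" for u using that \<sigma>B \<sigma>B' \<sigma>id disj by (metis subsetD)
  \<comment> \<open>A vertex of the old class other than \<open>v\<close> lies in \<open>B'\<close>
    or in \<open>C\<close>. Away from \<open>v\<close> and \<open>C\<close>, therefore,
    \<open>\<sigma>\<close> transposes the two colours and keeps different colours
    different.\<close>
  have c\<sigma>: "c (\<sigma> u) = (if c u = ?i then j else if c u = j then ?i else c u)"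
    if "u \<in> V" "u \<noteq> v" "u \<notin> C" for u
  proof -
    have col: "c w = ?i" if "w \<in> B'" for w using that B' by (auto simp: A_def color_class_def)
    have colB: "c w = j" if "w \<in> B" for w using that by (auto simp: B_def color_class_def)
    consider "u \<in> B" | "u \<in> B'" | "u \<notin> B" "u \<notin> B'" by blast
    then show ?thesis
    proof cases
      case 1
      then show ?thesis using col[OF \<sigma>B] colB \<open>c v \<noteq> j\<close> by simp
    next
      case 2
      then show ?thesis using colB[OF \<sigma>B'] col by simp
    next
      case 3
      then have "c u \<noteq> j" "c u \<noteq> ?i" using that by (auto simp: A_def B_def C_def color_class_def)
      then show ?thesis using \<sigma>id 3 by simp
    qed
  qed

  have through: "card {\<phi> \<in> emb W F V (multipartite d). v \<in> \<phi> ` W}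
    = (\<Sum>x\<in>W. card {\<phi> \<in> emb W F V (multipartite d). \<phi> x = v})" for d
  proof -
    have "{\<phi> \<in> emb W F V (multipartite d). v \<in> \<phi> ` W} = (\<Union>x\<in>W. {\<phi> \<in> emb W F V (multipartite d). \<phi> x = v})"
      by auto
    then show ?thesis using fin finite_W
      by (simp, subst card_UN_disjoint) (auto intro: finite_subset[OF _ finite_emb] simp: emb_def inj_on_def)
  qed
  have "card {\<phi> \<in> emb W F V (multipartite c). \<phi> x = v} \<le> card {\<phi> \<in> emb W F V (multipartite ?c'). \<phi> x = v}"
    if x: "x \<in> W" for x
  proof -
    define N where "N = {y. (x, y) \<in> F \<union> F\<inverse>}"
    have N: "N \<subseteq> W" "x \<notin> N" "finite N" using F_subset F_neq finite_W
      by (auto simp: N_def intro: finite_subset[of _ W])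
    \<comment> \<open>Edges at \<open>x\<close> are left unconstrained. Since \<open>v\<close> is
      the only vertex recoloured, \<open>\<Psi>\<close> is the same reference set for both
      colourings.\<close>
    define \<Psi> where "\<Psi> = {\<phi> \<in> W \<rightarrow>\<^sub>E V. inj_on \<phi> W \<and> \<phi> x = v \<and>
      (\<forall>(a, b)\<in>F. a \<noteq> x \<longrightarrow> b \<noteq> x \<longrightarrow> c (\<phi> a) \<noteq> c (\<phi> b))}"
    have fin\<Psi>: "finite \<Psi>" unfolding \<Psi>_def using finite_W fin
      by (intro finite_subset[OF _ finite_PiE[of W "\<lambda>_. V"]]) auto
    define hits where "hits S = {\<phi> \<in> \<Psi>. \<exists>y\<in>N. \<phi> y \<in> S}" for S
    have finhits: "finite (hits S)" for S using fin\<Psi> by (simp add: hits_def)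
    have nv: "\<phi> a \<noteq> v" "\<phi> a \<in> V" if "\<phi> \<in> \<Psi>" "a \<in> W" "a \<noteq> x" for \<phi> a
      using that x by (auto simp: \<Psi>_def dest: inj_onD)
    have FW: "a \<in> W \<and> b \<in> W" if "(a, b) \<in> F" for a b using that F_subset by auto
    have 1: "{\<phi> \<in> emb W F V (multipartite c). \<phi> x = v} = \<Psi> - hits A"
    proof (intro set_eqI iffI)
      fix \<phi> assume \<phi>: "\<phi> \<in> {\<phi> \<in> emb W F V (multipartite c). \<phi> x = v}"
      then have "\<phi> \<in> \<Psi>" by (auto simp: emb_def multipartite_def \<Psi>_def)
      moreover have "c (\<phi> y) \<noteq> c v" if "y \<in> N" for y
        using \<phi> that by (auto simp: emb_def multipartite_def N_def)
      ultimately show "\<phi> \<in> \<Psi> - hits A" by (auto simp: hits_def A_def color_class_def)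
    next
      fix \<phi> assume \<phi>: "\<phi> \<in> \<Psi> - hits A"
      then have y: "c (\<phi> y) \<noteq> c v" if "y \<in> N" for y
        using that N nv[of \<phi> y] by (auto simp: hits_def A_def color_class_def)
      have "c (\<phi> a) \<noteq> c (\<phi> b)" if ab: "(a, b) \<in> F" for a b
      proof -
        have "\<phi> x = v" using \<phi> by (simp add: \<Psi>_def)
        moreover have "a = x \<Longrightarrow> b \<in> N" "b = x \<Longrightarrow> a \<in> N" using ab by (auto simp: N_def)
        moreover have "a \<noteq> x \<Longrightarrow> b \<noteq> x \<Longrightarrow> c (\<phi> a) \<noteq> c (\<phi> b)" using \<phi> ab by (auto simp: \<Psi>_def)
        ultimately show ?thesis using y by metis
      qed
      then show "\<phi> \<in> {\<phi> \<in> emb W F V (multipartite c). \<phi> x = v}"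
        using \<phi> by (auto simp: emb_def multipartite_def \<Psi>_def)
    qed
    have 2: "{\<phi> \<in> emb W F V (multipartite ?c'). \<phi> x = v} = \<Psi> - hits B"
    proof (intro set_eqI iffI)
      fix \<phi> assume \<phi>: "\<phi> \<in> {\<phi> \<in> emb W F V (multipartite ?c'). \<phi> x = v}"
      have nv': "\<phi> a \<noteq> v" if "a \<in> W" "a \<noteq> x" for a
        using that x \<phi> by (auto simp: emb_def dest: inj_onD)
      have "c (\<phi> a) \<noteq> c (\<phi> b)" if "(a, b) \<in> F" "a \<noteq> x" "b \<noteq> x" for a b
        using \<phi> that nv'[of a] nv'[of b] FW[of a b] by (auto simp: emb_def multipartite_def)
      then have "\<phi> \<in> \<Psi>" using \<phi> by (auto simp: emb_def \<Psi>_def)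
      moreover have "c (\<phi> y) \<noteq> j" if "y \<in> N" for y
        using \<phi> that nv'[of y] N by (auto simp: emb_def multipartite_def N_def)
      ultimately show "\<phi> \<in> \<Psi> - hits B" by (auto simp: hits_def B_def color_class_def)
    next
      fix \<phi> assume \<phi>: "\<phi> \<in> \<Psi> - hits B"
      then have y: "?c' (\<phi> y) \<noteq> j" if "y \<in> N" for y
        using that N nv[of \<phi> y] by (auto simp: hits_def B_def color_class_def)
      have "?c' (\<phi> a) \<noteq> ?c' (\<phi> b)" if ab: "(a, b) \<in> F" for a b
      proof -
        have "?c' (\<phi> x) = j" using \<phi> by (simp add: \<Psi>_def)
        moreover have "a = x \<Longrightarrow> b \<in> N" "b = x \<Longrightarrow> a \<in> N" using ab by (auto simp: N_def)
        moreover have "?c' (\<phi> a) \<noteq> ?c' (\<phi> b)" if "a \<noteq> x" "b \<noteq> x"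
          using \<phi> ab that nv[of \<phi> a] nv[of \<phi> b] FW[OF ab] by (auto simp: \<Psi>_def)
        ultimately show ?thesis using y by metis
      qed
      then show "\<phi> \<in> {\<phi> \<in> emb W F V (multipartite ?c'). \<phi> x = v}"
        using \<phi> by (auto simp: emb_def multipartite_def \<Psi>_def simp del: fun_upd_apply)
    qed
    have "card (hits B) \<le> card (hits A)"
    proof (cases "N = {}")
      case True
      then show ?thesis by (simp add: hits_def)
    next
      case False
      then obtain y0 where y0: "y0 \<in> N" by auto
      then have y0W: "y0 \<in> W" "y0 \<noteq> x" using N by auto
      \<comment> \<open>Swapping handles the maps in \<open>av\<close>. A map that hits
        \<open>B\<close> but meets \<open>C\<close> has three prescribed vertices, hence order
        n^(h-3), whereas \<open>hits C\<close> prescribes two and has order n^(h-2).\<close>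
      define av where "av = {\<phi> \<in> \<Psi>. \<phi> ` W \<inter> C = {}}"
      have swap: "card (hits B \<inter> av) \<le> card (hits B' \<inter> av)"
      proof (rule card_inj_on_le)
        let ?f = "\<lambda>\<phi>. restrict (\<sigma> \<circ> \<phi>) W"
        show "inj_on ?f (hits B \<inter> av)"
        proof (rule inj_onI)
          fix \<phi> \<psi>
          assume m: "\<phi> \<in> hits B \<inter> av" "\<psi> \<in> hits B \<inter> av" and eq: "?f \<phi> = ?f \<psi>"
          have "\<phi> a = \<psi> a" if "a \<in> W" for a
            using fun_cong[OF eq, of a] that injD[OF inj\<sigma>] by auto
          then show "\<phi> = \<psi>" using m by (intro PiE_ext[of _ W "\<lambda>_. V"]) (auto simp: av_def \<Psi>_def)
        qed
        show "?f ` (hits B \<inter> av) \<subseteq> hits B' \<inter> av"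
        proof (rule image_subsetI)
          fix \<phi> assume m: "\<phi> \<in> hits B \<inter> av"
          then have \<phi>: "\<phi> \<in> \<Psi>" "\<phi> \<in> W \<rightarrow>\<^sub>E V" "inj_on \<phi> W" "\<phi> x = v"
            by (auto simp: av_def \<Psi>_def)
          have nC: "\<phi> a \<notin> C" if "a \<in> W" for a using m that by (auto simp: av_def)
          have f: "?f \<phi> a = \<sigma> (\<phi> a)" if "a \<in> W" for a using that by simp
          have "inj_on (\<sigma> \<circ> \<phi>) W" using inj_on_subset[OF inj\<sigma>] \<phi>(3) by (intro comp_inj_on) auto
          then have i: "inj_on (?f \<phi>) W" by (simp add: inj_on_def)
          have p: "?f \<phi> \<in> W \<rightarrow>\<^sub>E V" using \<phi>(2) \<sigma>V by (auto simp: PiE_def Pi_def)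
          have vx: "?f \<phi> x = v" using x \<phi>(4) \<sigma>id disj by simp
          have "c (?f \<phi> a) \<noteq> c (?f \<phi> b)" if ab: "(a, b) \<in> F" "a \<noteq> x" "b \<noteq> x" for a b
          proof -
            have W: "a \<in> W" "b \<in> W" using FW ab by auto
            have "c (\<phi> a) \<noteq> c (\<phi> b)" using \<phi>(1) ab by (auto simp: \<Psi>_def)
            then show ?thesis
              unfolding f[OF W(1)] f[OF W(2)]
              using c\<sigma>[of "\<phi> a"] c\<sigma>[of "\<phi> b"] nv[OF \<phi>(1)] nC W ab by auto
          qed
          then have \<Psi>: "?f \<phi> \<in> \<Psi>" using i p vx unfolding \<Psi>_def by blast
          have "\<sigma> (\<phi> a) \<notin> C" if "a \<in> W" for a
            using \<sigma>B[of "\<phi> a"] \<sigma>B'[of "\<phi> a"] \<sigma>id[of "\<phi> a"] disj nC[OF that] by (metis disjoint_iff)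
          then have "?f \<phi> \<in> av" using \<Psi> by (auto simp: av_def)
          moreover have "?f \<phi> \<in> hits B'" using m \<Psi> \<sigma>B N by (fastforce simp: hits_def)
          ultimately show "?f \<phi> \<in> hits B' \<inter> av" by blast
        qed
        show "finite (hits B' \<inter> av)" using finhits by simp
      qed
      have card2: "card (W - {x, y}) = ?h - 2" if "y \<in> N" for y
      proof -
        have "y \<in> W" "x \<noteq> y" using that N by auto
        then show ?thesis using x finite_W by (subst card_Diff_subset) auto
      qed
      have upper: "card (hits B - av) \<le> card (Sigma N (\<lambda>y. W - {x, y}) \<times> (B \<times> C)) * n ^ (?h - 3)"
      proof (rule card_le_mult_cover)
        let ?I = "Sigma N (\<lambda>y. W - {x, y}) \<times> (B \<times> C)"
        let ?A = "\<lambda>((y, z), (u, t)). {\<phi> \<in> W \<rightarrow>\<^sub>E V. \<forall>a\<in>{x, y, z}. \<phi> a = (if a = x then v else if a = y then u else t)}"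
        show "finite ?I" using N finite_W finAB C by simp
        show "finite (?A i)" for i
          using fin finite_W by (auto intro!: finite_subset[OF _ finite_PiE[of W "\<lambda>_. V"]] split: prod.splits)
        show "hits B - av \<subseteq> (\<Union>i\<in>?I. ?A i)"
        proof
          fix \<phi> assume \<phi>: "\<phi> \<in> hits B - av"
          then obtain y z where yz: "y \<in> N" "\<phi> y \<in> B" "z \<in> W" "\<phi> z \<in> C" and \<phi>': "\<phi> \<in> W \<rightarrow>\<^sub>E V" "\<phi> x = v"
            by (auto simp: hits_def av_def \<Psi>_def)
          then have "z \<noteq> x" "z \<noteq> y" using disj by auto
          then have "((y, z), (\<phi> y, \<phi> z)) \<in> ?I" "\<phi> \<in> ?A ((y, z), (\<phi> y, \<phi> z))" using yz \<phi>' by auto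
          then show "\<phi> \<in> (\<Union>i\<in>?I. ?A i)" by blast
        qed
        show "card (?A i) \<le> n ^ (?h - 3)" if "i \<in> ?I" for i
        proof -
          obtain y z u t where i: "i = ((y, z), (u, t))" by (metis surj_pair)
          then have "y \<in> W" "z \<in> W" "x \<noteq> y" "z \<noteq> x" "z \<noteq> y" using that N by auto
          then have eq3: "card (W - {x, y, z}) = ?h - 3" using x finite_W by (subst card_Diff_subset) auto
          show ?thesis unfolding i prod.case eq3[symmetric] n[symmetric]
            by (rule card_extensions_le[OF finite_W fin])
        qed
      qed
      have lower: "card C * (n - ?h * \<kappa>) ^ (?h - 2) \<le> card (hits C)"
      proof (rule mult_card_le_disjoint[OF C(2) finhits])
        \<comment> \<open>All images get different classes, except that \<open>v\<close> and
          \<open>u\<close> share one. This is harmless, because \<open>\<Psi>\<close> ignores the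
          edges at \<open>x\<close>.\<close>
        define D where "D = {(u, w). c u = c w}"
        let ?A = "\<lambda>u. {\<phi> \<in> ({x, y0} \<union> (W - {x, y0})) \<rightarrow>\<^sub>E V. (\<forall>a\<in>{x, y0}. \<phi> a = (if a = x then v else u)) \<and>
          (\<forall>a\<in>W - {x, y0}. \<phi> a \<in> V \<and> (\<forall>b\<in>{x, y0} \<union> (W - {x, y0}). b \<noteq> a \<longrightarrow> (\<phi> b, \<phi> a) \<notin> D))}"
        show "?A u \<subseteq> hits C" if u: "u \<in> C" for u
        proof
          fix \<phi> assume \<phi>: "\<phi> \<in> ?A u"
          have eq: "{x, y0} \<union> (W - {x, y0}) = W" using x y0W by auto
          have vals: "\<phi> x = v" "\<phi> y0 = u" "\<phi> \<in> W \<rightarrow>\<^sub>E V" using \<phi> y0W eq by auto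
          have other: "c (\<phi> b) \<noteq> c (\<phi> a)" if "a \<in> W" "b \<in> W" "b \<noteq> a" "a \<notin> {x, y0} \<or> b \<notin> {x, y0}" for a b
          proof -
            have *: "c (\<phi> b) \<noteq> c (\<phi> a)" if "a \<in> W - {x, y0}" "b \<in> W" "b \<noteq> a" for a b
              using \<phi> that unfolding eq by (auto simp: D_def)
            show ?thesis using that *[of a b] *[of b a] by (metis Diff_iff)
          qed
          have "u \<noteq> v" using u disj by auto
          then have "inj_on \<phi> W" using other vals by (intro inj_onI) (metis insertE singletonD)
          moreover have "c (\<phi> a) \<noteq> c (\<phi> b)" if "(a, b) \<in> F" "a \<noteq> x" "b \<noteq> x" for a b
            using that FW[OF that(1)] F_neq[OF that(1)] by (intro other) auto
          ultimately show "\<phi> \<in> hits C" using vals u y0 unfolding hits_def \<Psi>_def by blast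
        qed
        show "(n - ?h * \<kappa>) ^ (?h - 2) \<le> card (?A u)" if "u \<in> C" for u
        proof -
          have uV: "u \<in> V" using that disj by auto
          have "(card V - ?h * \<kappa>) ^ card (W - {x, y0}) \<le> card (?A u)"
            using fin finite_W v uV
          proof (intro card_ge_greedy_extensions)
            show "card {w \<in> V. (a, w) \<in> D} \<le> \<kappa>" for a
            proof -
              have "{w \<in> V. (a, w) \<in> D} = color_class V c (c a)" by (auto simp: D_def color_class_def)
              then show ?thesis using cls by simp
            qed
            show "card ({x, y0} \<union> (W - {x, y0})) \<le> ?h" using x y0W finite_W by (intro card_mono) auto
            show "sym D" by (auto simp: D_def sym_def)
          qed auto
          then show ?thesis using card2[OF y0] n by simp
        qed
        show "u = u'" if "\<phi> \<in> ?A u" "\<phi> \<in> ?A u'" for u u' \<phi>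
        proof -
          have "\<phi> y0 = u" "\<phi> y0 = u'" using that y0W by auto
          then show ?thesis by simp
        qed
      qed
      have "card (hits B - av) \<le> card (hits C)"
      proof (cases "?h \<ge> 3")
        \<comment> \<open>Without a third pattern vertex, no map can send one vertex besides
          \<open>x\<close> into \<open>B\<close> and another into \<open>C\<close>.\<close>
        case False
        then have "card (Sigma N (\<lambda>y. W - {x, y})) = 0" using card2 finite_W N by (subst card_SigmaI) auto
        then show ?thesis using upper by (simp add: card_cartesian_product)
      next
        case True
        have "card (Sigma N (\<lambda>y. W - {x, y})) = card N * (?h - 2)"
          using card2 finite_W N by (subst card_SigmaI) auto
        also have "\<dots> \<le> ?h * ?h" using N finite_W by (intro mult_mono) (auto intro: card_mono)
        finally have s: "card (Sigma N (\<lambda>y. W - {x, y})) \<le> ?h * ?h" .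
        \<comment> \<open>Since \<open>card B\<close> is at most \<open>\<kappa>\<close>, the
          hypothesis \<open>large\<close> bounds the constant
          \<open>2 * ?h * (?h * \<kappa>)\<close> by \<open>n\<close>, which supplies the missing
          power; \<open>card C\<close> occurs on both sides.\<close>
        have "2 * card (hits B - av) \<le> 2 * ((?h * ?h) * (\<kappa> * card C) * n ^ (?h - 3))"
          using upper s cls[of j] unfolding B_def[symmetric] card_cartesian_product
          by (meson order.trans mult_le_mono le_refl)
        also have "\<dots> = card C * ((2 * ?h * (?h * \<kappa>)) * n ^ (?h - 3))" by (simp add: mult_ac)
        also have "\<dots> \<le> card C * (n * n ^ (?h - 3))" using large by (intro mult_le_mono) auto
        also have "n * n ^ (?h - 3) = n ^ (?h - 2)"
        proof -
          have "?h - 2 = Suc (?h - 3)" using True by simp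
          then show ?thesis by simp
        qed
        also have "card C * n ^ (?h - 2) \<le> card C * (2 * (n - ?h * \<kappa>) ^ (?h - 2))"
        proof (intro mult_left_mono Bernoulli_nat)
          have "2 * (?h - 2) * (?h * \<kappa>) \<le> 2 * ?h * (?h * \<kappa>)" by (intro mult_right_mono) auto
          then show "2 * (?h - 2) * (?h * \<kappa>) \<le> n" using large by linarith
        qed simp
        also have "\<dots> \<le> 2 * card (hits C)" using lower by simp
        finally show ?thesis by simp
      qed
      moreover have "card (hits B) = card (hits B \<inter> av) + card (hits B - av)"
        using finhits by (subst card_Un_disjoint[symmetric]) (auto intro!: arg_cong[of _ _ card])
      moreover have "card (hits B' \<inter> av) + card (hits C) \<le> card (hits A)"
      proof -
        have "hits B' \<inter> av \<inter> hits C = {}" using N by (auto simp: hits_def av_def)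
        then have "card (hits B' \<inter> av) + card (hits C) = card (hits B' \<inter> av \<union> hits C)"
          using finhits by (intro card_Un_disjoint[symmetric]) auto
        also have "\<dots> \<le> card (hits A)"
          using finhits B'(1) disj by (intro card_mono) (auto simp: hits_def)
        finally show ?thesis .
      qed
      ultimately show ?thesis using swap by linarith
    qed
    moreover have "card (\<Psi> - hits A) = card \<Psi> - card (hits A)" "card (\<Psi> - hits B) = card \<Psi> - card (hits B)"
      using finhits by (auto intro!: card_Diff_subset simp: hits_def)
    ultimately show ?thesis unfolding 1 2 by linarith
  qed
  then have "card {\<phi> \<in> emb W F V (multipartite c). v \<in> \<phi> ` W} \<le> card {\<phi> \<in> emb W F V (multipartite ?c'). v \<in> \<phi> ` W}"
    unfolding through by (rule sum_mono)
  moreover have "emb W F (V - {v}) (multipartite c) = emb W F (V - {v}) (multipartite ?c')"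
  proof -
    have "c (\<phi> a) = ?c' (\<phi> a)" if "\<phi> \<in> W \<rightarrow>\<^sub>E V - {v}" "a \<in> W" for \<phi> a using that by auto
    then have "(\<phi> a, \<phi> b) \<in> multipartite c \<longleftrightarrow> (\<phi> a, \<phi> b) \<in> multipartite ?c'"
      if "\<phi> \<in> W \<rightarrow>\<^sub>E V - {v}" "(a, b) \<in> F" for \<phi> a b
      using F_subset that by (auto simp: multipartite_def)
    then show ?thesis unfolding emb_def by blast
  qed
  ultimately show ?thesis
    using card_emb_split[OF finite_W fin, of F "multipartite c" v]
      card_emb_split[OF finite_W fin, of F "multipartite ?c'" v] by simp
qed

end

section \<open>Balanced colourings\<close>

text \<open>The pairwise form covers empty classes as well, and its failure directly provides the
  two classes between which a vertex is moved.\<close>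

definition balanced :: "nat \<Rightarrow> 'b set \<Rightarrow> ('b \<Rightarrow> nat) \<Rightarrow> bool" where
  "balanced r V c \<longleftrightarrow> c ` V \<subseteq> {..<r} \<and>
    (\<forall>i<r. \<forall>j<r. card (color_class V c i) \<le> card (color_class V c j) + 1)"

lemma finite_color_class: "finite V \<Longrightarrow> finite (color_class V c i)"
  by (simp add: color_class_def)

lemma sum_card_color_class:
  assumes "finite V" "c ` V \<subseteq> {..<r}"
  shows "(\<Sum>i<r. card (color_class V c i)) = card V"
proof -
  have "V = (\<Union>i<r. color_class V c i)" using assms(2) by (auto simp: color_class_def)
  also have "card \<dots> = (\<Sum>i<r. card (color_class V c i))"
    using assms(1) by (intro card_UN_disjoint) (auto simp: color_class_def)
  finally show ?thesis by simp
qed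

text \<open>Averaging: a class below the quotient would keep all others at or below it, so the total
  would be too small; a class above \<open>card V div r + 1\<close> would make it too large.\<close>

lemma balanced_card_color_class:
  assumes "finite V" "balanced r V c" "i < r"
  shows "card (color_class V c i) \<in> {card V div r, card V div r + 1}"
proof -
  let ?f = "\<lambda>i. card (color_class V c i)" and ?q = "card V div r"
  have bal: "?f i \<le> ?f j + 1" "?f j \<le> ?f i + 1" if "j < r" for j
    using assms that by (auto simp: balanced_def)
  have sum: "(\<Sum>i<r. ?f i) = card V"
    using assms by (intro sum_card_color_class) (auto simp: balanced_def)
  have "?q \<le> ?f i"
  proof (rule ccontr)
    assume "\<not> ?q \<le> ?f i"
    then have lt: "?f i < ?q" by simp
    have "?f j \<le> ?q" if "j < r" for j using bal(2)[OF that] lt by linarith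
    then have "(\<Sum>i<r. ?f i) < (\<Sum>i<r. ?q)"
      using lt assms(3) by (intro sum_strict_mono_ex1) auto
    then have "card V < r * ?q" using sum by simp
    then show False using times_div_less_eq_dividend[of r "card V"] by linarith
  qed
  moreover have "?f i \<le> ?q + 1"
  proof (rule ccontr)
    assume "\<not> ?f i \<le> ?q + 1"
    then have lt: "?q + 1 < ?f i" by simp
    have "?q + 1 \<le> ?f j" if "j < r" for j using bal(1)[OF that] lt by linarith
    then have "(\<Sum>i<r. ?q + 1) < (\<Sum>i<r. ?f i)"
      using lt assms(3) by (intro sum_strict_mono_ex1) auto
    then have "r * (?q + 1) < card V" using sum by simp
    then show False using assms(3) dividend_less_times_div[of r "card V"] by simp
  qed
  ultimately show ?thesis by auto
qed

text \<open>The bound is the ceiling of \<open>card V / r\<close>. When \<open>r\<close> divides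
  \<open>card V\<close> it is one less than \<open>card V div r + 1\<close>, and it is this sharper
  value that matches \<open>\<tau> + 1\<close> in the induction.\<close>

lemma balanced_card_color_class_le:
  assumes "finite V" "balanced r V c" "i < r" "V \<noteq> {}"
  shows "card (color_class V c i) \<le> (card V - 1) div r + 1"
proof (rule ccontr)
  let ?f = "\<lambda>i. card (color_class V c i)" and ?q = "(card V - 1) div r"
  assume "\<not> ?f i \<le> ?q + 1"
  then have lt: "?q + 1 < ?f i" by simp
  have "?f i \<le> ?f j + 1" if "j < r" for j using assms that by (auto simp: balanced_def)
  then have "?q + 1 \<le> ?f j" if "j < r" for j using lt that by fastforce
  then have "(\<Sum>i<r. ?q + 1) < (\<Sum>i<r. ?f i)"
    using lt assms(3) by (intro sum_strict_mono_ex1) auto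
  also have "(\<Sum>i<r. ?f i) = card V"
    using assms by (intro sum_card_color_class) (auto simp: balanced_def)
  finally have "r * (?q + 1) \<le> card V - 1" by simp
  then show False using assms(3) dividend_less_times_div[of r "card V - 1"] by simp
qed

text \<open>Together with the two possible sizes, this determines the multiset of class sizes from
  \<open>card V\<close> and \<open>r\<close> alone.\<close>

lemma balanced_card_large_classes:
  assumes "finite V" "balanced r V c"
  shows "card {i \<in> {..<r}. card (color_class V c i) = card V div r + 1} = card V mod r"
proof -
  let ?f = "\<lambda>i. card (color_class V c i)" and ?q = "card V div r"
  let ?L = "{i \<in> {..<r}. ?f i = ?q + 1}"
  have "card V = (\<Sum>i<r. ?f i)"
    using assms by (intro sum_card_color_class[symmetric]) (auto simp: balanced_def)
  also have "\<dots> = (\<Sum>i<r. ?q + (if i \<in> ?L then 1 else 0))"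
    using balanced_card_color_class[OF assms] by (intro sum.cong) auto
  also have "\<dots> = r * ?q + card ?L"
    by (simp only: sum.distrib sum.If_cases[OF finite_lessThan]) (auto intro!: arg_cong[of _ _ card])
  finally show ?thesis using mult_div_mod_eq[of r "card V"] by linarith
qed

text \<open>The two multipartite graphs are isomorphic: colours of large classes are matched with
  each other, the remaining colours likewise, and then the vertices class by class.\<close>

lemma card_emb_balanced_le:
  assumes "finite W" "F \<subseteq> W \<times> W" "finite V" "finite V'" "card V = card V'"
    and "balanced r V c" "balanced r V' c'"
  shows "card (emb W F V (multipartite c)) \<le> card (emb W F V' (multipartite c'))"
proof -
  let ?q = "card V div r"
  let ?L = "{i \<in> {..<r}. card (color_class V c i) = ?q + 1}"
  let ?L' = "{i \<in> {..<r}. card (color_class V' c' i) = ?q + 1}"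
  have "card ?L = card ?L'" 
    using balanced_card_large_classes[OF assms(3,6)] balanced_card_large_classes[OF assms(4,7)] assms(5) by simp
  then obtain \<pi>1 where \<pi>1: "bij_betw \<pi>1 ?L ?L'"
    using finite_same_card_bij[of ?L ?L'] by auto
  have "card ({..<r} - ?L) = card ({..<r} - ?L')"
    using \<open>card ?L = card ?L'\<close> by (subst (1 2) card_Diff_subset) auto
  then obtain \<pi>2 where \<pi>2: "bij_betw \<pi>2 ({..<r} - ?L) ({..<r} - ?L')"
    using finite_same_card_bij[of "{..<r} - ?L" "{..<r} - ?L'"] by auto
  define \<pi> where "\<pi> i = (if i \<in> ?L then \<pi>1 i else \<pi>2 i)" for i
  have "bij_betw \<pi> (?L \<union> ({..<r} - ?L)) (?L' \<union> ({..<r} - ?L'))"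
    unfolding \<pi>_def by (rule bij_betw_disjoint_Un[OF \<pi>1 \<pi>2]) auto
  moreover have "?L \<union> ({..<r} - ?L) = {..<r}" "?L' \<union> ({..<r} - ?L') = {..<r}" by auto
  ultimately have \<pi>: "bij_betw \<pi> {..<r} {..<r}" by simp
  have card\<pi>: "card (color_class V c i) = card (color_class V' c' (\<pi> i))" if i: "i < r" for i
  proof (cases "i \<in> ?L")
    case True
    then have "\<pi> i \<in> ?L'" using \<pi>1 by (auto simp: \<pi>_def bij_betw_def)
    then show ?thesis using True by simp
  next
    case False
    then have "\<pi> i \<in> {..<r} - ?L'" using \<pi>2 i by (auto simp: \<pi>_def bij_betw_def)
    then show ?thesis
      using False i balanced_card_color_class[OF assms(3,6) i]
        balanced_card_color_class[OF assms(4,7), of "\<pi> i"] assms(5) by auto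
  qed
  have "\<forall>i\<in>{..<r}. \<exists>g. bij_betw g (color_class V c i) (color_class V' c' (\<pi> i))"
    using card\<pi> assms by (auto intro!: finite_same_card_bij finite_color_class)
  then obtain G where G: "\<And>i. i < r \<Longrightarrow> bij_betw (G i) (color_class V c i) (color_class V' c' (\<pi> i))"
    by (metis lessThan_iff)
  define g where "g u = G (c u) u" for u
  have g: "g u \<in> V'" "c' (g u) = \<pi> (c u)" if "u \<in> V" for u
  proof -
    have "c u < r" using that assms(6) by (auto simp: balanced_def)
    moreover have "u \<in> color_class V c (c u)" using that by (simp add: color_class_def)
    ultimately have "g u \<in> color_class V' c' (\<pi> (c u))"
      unfolding g_def by (intro bij_betw_apply[OF G])
    then show "g u \<in> V'" "c' (g u) = \<pi> (c u)" by (auto simp: color_class_def)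
  qed
  have col: "c u = c v" if "u \<in> V" "v \<in> V" "\<pi> (c u) = \<pi> (c v)" for u v
  proof -
    have "c u < r" "c v < r" using that assms(6) by (auto simp: balanced_def)
    then show ?thesis using that(3) bij_betw_imp_inj_on[OF \<pi>] by (auto dest: inj_onD)
  qed
  have "inj_on g V"
  proof (rule inj_onI)
    fix u v assume uv: "u \<in> V" "v \<in> V" "g u = g v"
    then have cuv: "c u = c v" using g col by metis
    have "c u < r" using uv assms(6) by (auto simp: balanced_def)
    then have "inj_on (G (c u)) (color_class V c (c u))" using G bij_betw_def by blast
    then show "u = v" using uv cuv by (auto simp: g_def color_class_def dest: inj_onD)
  qed
  then show ?thesis using assms g col
    by (intro card_emb_mono_bij[where g = g]) (auto simp: multipartite_def)
qed

text \<open>Pigeonhole on the colours. It lets the induction hypothesis apply after the given graph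
  has been replaced by a multipartite one.\<close>

lemma multipartite_clique_free:
  assumes "finite V" "c ` V \<subseteq> {..<r}" "K \<subseteq> V" "card K = r + 1"
  shows "\<exists>u\<in>K. \<exists>v\<in>K. u \<noteq> v \<and> (u, v) \<notin> multipartite c"
proof (rule ccontr)
  assume "\<not> ?thesis"
  then have "inj_on c K" by (auto simp: multipartite_def inj_on_def)
  then have "card K \<le> card {..<r}" using assms by (intro card_inj_on_le[of c]) auto
  then show False using assms(4) by simp
qed

text \<open>Replacing sizes a >= b + 2 by a - 1 and b + 1 changes the sum of squares by 2(b - a + 1)
  < 0. This is the measure that makes balancing terminate.\<close>

lemma sum_squares_color_class_move:
  assumes "finite V" "v \<in> V" "c v < r" "j < r" "c v \<noteq> j"
    and "card (color_class V c j) + 2 \<le> card (color_class V c (c v))"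
  shows "(\<Sum>i<r. (card (color_class V (c(v := j)) i))\<^sup>2) < (\<Sum>i<r. (card (color_class V c i))\<^sup>2)"
proof -
  let ?c' = "c(v := j)" and ?R = "{..<r} - {c v} - {j}"
  have split: "(\<Sum>i<r. f i) = f (c v) + (f j + (\<Sum>i\<in>?R. f i))" for f :: "nat \<Rightarrow> nat"
    using assms by (simp add: sum.remove[of "{..<r}" "c v"] sum.remove[of "{..<r} - {c v}" j])
  have "color_class V ?c' (c v) = color_class V c (c v) - {v}"
    "color_class V ?c' j = insert v (color_class V c j)" using assms by (auto simp: color_class_def)
  then have 1: "card (color_class V ?c' (c v)) = card (color_class V c (c v)) - 1"
    "card (color_class V ?c' j) = card (color_class V c j) + 1"
    using assms finite_color_class[OF assms(1)] by (auto simp: color_class_def)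
  have "color_class V ?c' i = color_class V c i" if "i \<in> ?R" for i
    using that by (auto simp: color_class_def)
  then have 2: "(\<Sum>i\<in>?R. (card (color_class V ?c' i))\<^sup>2) = (\<Sum>i\<in>?R. (card (color_class V c i))\<^sup>2)"
    by (intro sum.cong) auto
  obtain d where "card (color_class V c (c v)) = card (color_class V c j) + 2 + d"
    using assms(6) by (metis le_Suc_ex)
  then show ?thesis unfolding split 1 2 by (simp add: power2_eq_square algebra_simps)
qed

text \<open>These are the largeness conditions of the deletion, partition and move lemmas, the last
  two with \<open>\<kappa> = h * \<tau>\<close>. Each left side is at most 4 h^3
  \<open>\<tau>\<close>, whereas n >= r \<open>\<tau>\<close> >= 40 h^3
  \<open>\<tau>\<close>.\<close>

lemma cube_bounds:
  fixes h r \<tau> n :: nat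
  assumes "1 \<le> h" "1 \<le> \<tau>" "40 * h ^ 3 \<le> r" "r * \<tau> \<le> n"
  shows "2 * h * (h * \<tau> + h) \<le> n" "2 * h * (h * (2 * (h * \<tau>))) \<le> n" "2 * h * (h * (h * \<tau>)) \<le> n"
proof -
  let ?c = "h * (h * (h * \<tau>))"
  have "40 * h ^ 3 * \<tau> \<le> r * \<tau>" using assms(3) by (rule mult_right_mono) simp
  moreover have "40 * h ^ 3 * \<tau> = 40 * ?c" by (simp add: power3_eq_cube)
  ultimately have n: "40 * ?c \<le> n" using assms(4) by linarith
  have "2 * h * (h * (2 * (h * \<tau>))) = 4 * ?c" "2 * h * (h * (h * \<tau>)) = 2 * ?c" by simp_all
  then show "2 * h * (h * (2 * (h * \<tau>))) \<le> n" "2 * h * (h * (h * \<tau>)) \<le> n" using n by linarith+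
  have "h \<le> h * \<tau>" "h * \<tau> \<le> h * (h * \<tau>)" using assms by auto
  then have "h * \<tau> + h \<le> 2 * (h * (h * \<tau>))" by linarith
  then have "2 * h * (h * \<tau> + h) \<le> 2 * h * (2 * (h * (h * \<tau>)))" by (rule mult_left_mono) simp
  also have "\<dots> = 4 * ?c" by simp
  finally show "2 * h * (h * \<tau> + h) \<le> n" using n by linarith
qed

section \<open>The induction on the number of vertices\<close>

context pattern
begin

text \<open>Arbitrary relations \<open>E\<close> make it possible to delete a vertex by shrinking
  \<open>V\<close> alone. The colouring \<open>c'\<close> can stay fixed, because it remains
  balanced when a vertex of a largest class is removed.\<close>

lemma card_emb_le_balanced:
  fixes V :: "'b set" and V' :: "'c set"
  assumes "card W \<ge> 1" "r \<ge> 40 * card W ^ 3"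
    and "finite V" "card V = n" "sym E" "irrefl E"
    and "\<And>K. K \<subseteq> V \<Longrightarrow> card K = r + 1 \<Longrightarrow> \<exists>u\<in>K. \<exists>v\<in>K. u \<noteq> v \<and> (u, v) \<notin> E"
    and "finite V'" "card V' = n" "balanced r V' c'"
  shows "card (emb W F V E) \<le> card (emb W F V' (multipartite c'))"
  using assms(3-)
proof (induction n arbitrary: V E V' rule: less_induct)
  case (less n)
  have "r > 0" using assms(1,2) by (metis le_zero_eq mult_eq_0_iff not_gr_zero not_one_le_zero power_eq_0_iff zero_neq_numeral)
  show ?case
  proof (cases "n \<le> r")
    case True
    \<comment> \<open>No class has two vertices, so the target is complete and every injection is
      counted.\<close>
    have "inj_on c' V'"
    proof (rule inj_onI)
      fix u v assume uv: "u \<in> V'" "v \<in> V'" "c' u = c' v"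
      then have "c' u < r" "V' \<noteq> {}" using less.prems(8) by (auto simp: balanced_def)
      moreover have "(card V' - 1) div r = 0" using True \<open>r > 0\<close> less.prems(7) by simp
      ultimately have "card (color_class V' c' (c' u)) \<le> 1"
        using balanced_card_color_class_le[OF less.prems(6,8)] by (metis add_0)
      moreover have "u \<in> color_class V' c' (c' u)" "v \<in> color_class V' c' (c' u)"
        using uv by (auto simp: color_class_def)
      ultimately show "u = v"
        using finite_color_class[OF less.prems(6)] by (metis One_nat_def card_le_Suc0_iff_eq)
    qed
    have "card (emb W F V E) \<le> card (emb W {} V UNIV)"
      using finite_W less.prems by (intro card_mono finite_emb) (auto simp: emb_def)
    also have "\<dots> = card (emb W {} V' UNIV)"
      using finite_W less.prems by (intro card_injections_eq) auto
    also have "\<dots> \<le> card (emb W F V' (multipartite c'))"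
    proof (intro card_mono finite_emb finite_W less.prems subsetI)
      fix \<phi> assume \<phi>: "\<phi> \<in> emb W {} V' UNIV"
      have "c' (\<phi> x) \<noteq> c' (\<phi> y)" if "(x, y) \<in> F" for x y
      proof -
        have "x \<in> W" "y \<in> W" "x \<noteq> y" using that F_subset F_neq by auto
        then have "\<phi> x \<in> V'" "\<phi> y \<in> V'" "\<phi> x \<noteq> \<phi> y" using \<phi> by (auto simp: emb_def dest: inj_onD)
        then show ?thesis using \<open>inj_on c' V'\<close> by (auto dest: inj_onD)
      qed
      then show "\<phi> \<in> emb W F V' (multipartite c')" using \<phi> by (auto simp: emb_def multipartite_def)
    qed
    finally show ?thesis .
  next
    case False
    let ?h = "card W"
    \<comment> \<open>With \<open>n - 1\<close> instead of \<open>n\<close>,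
      \<open>\<tau> + 1\<close> is the ceiling of \<open>n / r\<close> even when \<open>r\<close>
      divides \<open>n\<close>.\<close>
    define \<tau> where "\<tau> = (n - 1) div r"
    have "r * 1 \<le> n - 1" using False by simp
    then have "1 \<le> \<tau>" unfolding \<tau>_def using \<open>r > 0\<close> by (simp add: less_eq_div_iff_mult_less_eq)
    have "r * \<tau> \<le> n - 1" unfolding \<tau>_def by (rule times_div_less_eq_dividend)
    then have "r * \<tau> \<le> n" by simp
    note large = cube_bounds[OF assms(1) \<open>1 \<le> \<tau>\<close> assms(2) \<open>r * \<tau> \<le> n\<close>]
    have ne: "V' \<noteq> {}" "n \<ge> 1" using less.prems(7) False by auto
    \<comment> \<open>Deletion is stated for any clique-free \<open>E'\<close> with at least as many
      copies, since it serves both the given graph and the multipartite graphs met while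
      balancing.\<close>
    have remove: ?thesis if le: "card (emb W F V E) \<le> card (emb W F V E')" and E': "sym E'" "irrefl E'"
      and free: "\<And>K. K \<subseteq> V \<Longrightarrow> card K = r + 1 \<Longrightarrow> \<exists>u\<in>K. \<exists>v\<in>K. u \<noteq> v \<and> (u, v) \<notin> E'"
      and v: "v \<in> V" "?h * \<tau> \<le> card {u \<in> V. u \<noteq> v \<and> (v, u) \<notin> E'}" for E' v
    proof -
      let ?f = "\<lambda>i. card (color_class V' c' i)"
      \<comment> \<open>Removing a vertex from a class that is not largest could leave two sizes
        differing by two.\<close>
      obtain i where i: "i < r" "\<And>j. j < r \<Longrightarrow> ?f j \<le> ?f i"
      proof -
        have "Max (?f ` {..<r}) \<in> ?f ` {..<r}" using \<open>r > 0\<close> by (intro Max_in) auto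
        then obtain i where i: "i < r" "Max (?f ` {..<r}) = ?f i" by auto
        have "?f j \<le> ?f i" if "j < r" for j unfolding i(2)[symmetric] using that by (intro Max_ge) auto
        then show thesis using i(1) that by blast
      qed
      have "(\<Sum>i<r. ?f i) = n"
        using less.prems(6-8) by (subst sum_card_color_class) (auto simp: balanced_def)
      then have "?f i \<noteq> 0" using i ne(2) by (metis (no_types, lifting) lessThan_iff le_zero_eq not_one_le_zero sum.neutral)
      then obtain w where w: "w \<in> V'" "c' w = i" by (auto simp: color_class_def card_eq_0_iff)
      have cw: "card (color_class (V' - {w}) c' j) = (if j = i then ?f i - 1 else ?f j)" for j
      proof -
        have "color_class (V' - {w}) c' j = (if j = i then color_class V' c' i - {w} else color_class V' c' j)"
          using w by (auto simp: color_class_def)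
        then show ?thesis using w less.prems(6) by (simp add: color_class_def)
      qed
      have bal: "balanced r (V' - {w}) c'"
        unfolding balanced_def cw
      proof (intro conjI allI impI)
        show "c' ` (V' - {w}) \<subseteq> {..<r}" using less.prems(8) by (auto simp: balanced_def)
        fix a b assume "a < r" "b < r"
        then have "?f a \<le> ?f b + 1" "?f a \<le> ?f i" using less.prems(8) i by (auto simp: balanced_def)
        then show "(if a = i then ?f i - 1 else ?f a) \<le> (if b = i then ?f i - 1 else ?f b) + 1"
          by auto
      qed
      have del: "card (emb W F (V - {v}) E') \<le> card (emb W F (V' - {w}) (multipartite c'))"
      proof (rule less.IH[of "n - 1"])
        show "n - 1 < n" "card (V - {v}) = n - 1" "card (V' - {w}) = n - 1"
          "finite (V - {v})" "finite (V' - {w})"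
          using less.prems(1,2,6,7) v(1) w(1) ne(2) by auto
        show "\<exists>u\<in>K. \<exists>v\<in>K. u \<noteq> v \<and> (u, v) \<notin> E'" if "K \<subseteq> V - {v}" "card K = r + 1" for K
          using that by (intro free) auto
      qed (use E' bal in auto)
      have thr: "card {\<phi> \<in> emb W F V E'. v \<in> \<phi> ` W}
          \<le> card {\<phi> \<in> emb W F V' (multipartite c'). w \<in> \<phi> ` W}"
      proof (rule card_emb_through_le[OF less.prems(1,6,2,7) v(1) w(1) E'(1) v(2) _ large(1)])
        fix u assume "u \<in> V'"
        then have "c' u < r" using less.prems(8) by (auto simp: balanced_def)
        then show "card (color_class V' c' (c' u)) \<le> \<tau> + 1"
          unfolding \<tau>_def using balanced_card_color_class_le[OF less.prems(6,8) _ ne(1)] less.prems(7) by simp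
      qed
      show ?thesis
        using le del thr card_emb_split[OF finite_W less.prems(1), of F E' v]
          card_emb_split[OF finite_W less.prems(6), of F "multipartite c'" w] by linarith
    qed
    have sm: "sym (multipartite c)" "irrefl (multipartite c)" for c :: "'b \<Rightarrow> nat"
      by (auto simp: multipartite_def sym_def irrefl_def)
    \<comment> \<open>A set of non-neighbours that includes \<open>v\<close> has one element more
      than the set in the degree condition; the strict inequality obtained by negating that
      condition pays for it.\<close>
    have bound: "card S \<le> ?h * \<tau>" if "S = insert v T" "\<not> ?h * \<tau> \<le> card T" for S T :: "'b set" and v
      using that card_insert_le_m1[of "?h * \<tau>" T v] by (cases "finite T") (auto simp: card_insert_if)
    \<comment> \<open>A move is justified only while all classes have at most
      \<open>?h * \<tau>\<close> vertices. If a class is larger, its vertices have enough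
      non-neighbours for \<open>remove\<close> to finish at once.\<close>
    have colored: ?thesis if "c ` V \<subseteq> {..<r}" "card (emb W F V E) \<le> card (emb W F V (multipartite c))" for c
      using that
    proof (induction "\<Sum>i<r. (card (color_class V c i))\<^sup>2" arbitrary: c rule: less_induct)
      case (less c)
      show ?case
      proof (cases "\<exists>v\<in>V. ?h * \<tau> \<le> card {u \<in> V. u \<noteq> v \<and> (v, u) \<notin> multipartite c}")
        case True
        then obtain v where "v \<in> V" "?h * \<tau> \<le> card {u \<in> V. u \<noteq> v \<and> (v, u) \<notin> multipartite c}" by blast
        then show ?thesis
          using less.prems \<open>finite V\<close> sm by (intro remove[of "multipartite c" v] multipartite_clique_free) auto
      next
        case False
        have cls: "card (color_class V c i) \<le> ?h * \<tau>" for i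
        proof (cases "color_class V c i = {}")
          case ne: False
          then obtain v where v: "v \<in> V" "c v = i" by (auto simp: color_class_def)
          then have "color_class V c i = insert v {u \<in> V. u \<noteq> v \<and> (v, u) \<notin> multipartite c}"
            by (auto simp: color_class_def multipartite_def)
          then show ?thesis using False v by (intro bound) auto
        qed simp
        show ?thesis
        proof (cases "balanced r V c")
          case True
          then show ?thesis
            using card_emb_balanced_le[OF finite_W F_subset \<open>finite V\<close> \<open>finite V'\<close> _ True \<open>balanced r V' c'\<close>]
              less.prems(2) \<open>card V = n\<close> \<open>card V' = n\<close> by simp
        next
          case False
          then obtain i j where ij: "i < r" "j < r" "card (color_class V c j) + 2 \<le> card (color_class V c i)"
            using less.prems(1) by (auto simp: balanced_def not_le)
          then have "color_class V c i \<noteq> {}" by auto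
          then obtain v where v: "v \<in> V" "c v = i" by (auto simp: color_class_def)
          have "c v \<noteq> j" using v ij by auto
          have "card (emb W F V (multipartite c)) \<le> card (emb W F V (multipartite (c(v := j))))"
            using \<open>c v \<noteq> j\<close> v ij cls large(3) \<open>finite V\<close> \<open>card V = n\<close>
            by (intro card_emb_le_move[where \<kappa> = "?h * \<tau>"]) auto
          moreover have "(\<Sum>i<r. (card (color_class V (c(v := j)) i))\<^sup>2) < (\<Sum>i<r. (card (color_class V c i))\<^sup>2)"
            using v ij \<open>c v \<noteq> j\<close> \<open>finite V\<close> by (intro sum_squares_color_class_move) auto
          ultimately show ?thesis using less.prems ij(2) by (intro less.hyps[of "c(v := j)"]) auto
        qed
      qed
    qed
    show ?thesis
    proof (cases "\<exists>v\<in>V. ?h * \<tau> \<le> card {u \<in> V. u \<noteq> v \<and> (v, u) \<notin> E}")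
      case True
      then show ?thesis using remove[of E] less.prems by blast
    next
      case False
      obtain c where c: "c ` V \<subseteq> {..<r}" "\<And>u. u \<in> V \<Longrightarrow> \<exists>x\<in>V. color_class V c (c u) \<subseteq> {w \<in> V. (x, w) \<notin> E}"
        "2 * card {(u, v). u \<in> V \<and> v \<in> V \<and> (u, v) \<in> E \<and> c u = c v}
          \<le> card {(u, v). u \<in> V \<and> v \<in> V \<and> (u, v) \<notin> E \<and> c u \<noteq> c v}"
        using clique_free_partition[of V E r] less.prems(1,3-5) by blast
      have deg: "card {w \<in> V. (v, w) \<notin> E} \<le> ?h * \<tau>" if "v \<in> V" for v
      proof (rule bound)
        show "{w \<in> V. (v, w) \<notin> E} = insert v {u \<in> V. u \<noteq> v \<and> (v, u) \<notin> E}"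
          using that less.prems(4) by (auto simp: irrefl_def)
        show "\<not> ?h * \<tau> \<le> card {u \<in> V. u \<noteq> v \<and> (v, u) \<notin> E}" using False that by blast
      qed
      have "card (color_class V c (c v)) \<le> ?h * \<tau>" if "v \<in> V" for v
      proof -
        obtain x where x: "x \<in> V" "color_class V c (c v) \<subseteq> {w \<in> V. (x, w) \<notin> E}" using c(2) \<open>v \<in> V\<close> by blast
        then have "card (color_class V c (c v)) \<le> card {w \<in> V. (x, w) \<notin> E}"
          using less.prems(1) by (intro card_mono) auto
        then show ?thesis using deg[OF x(1)] by linarith
      qed
      then have "card (emb W F V E) \<le> card (emb W F V (multipartite c))"
        using card_emb_le_multipartite[OF less.prems(1-3) c(3) deg _ large(2)] by blast
      then show ?thesis using colored c(1) by blast
    qed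
  qed
qed

end

section \<open>From graphs to oriented patterns and missing pairs\<close>

lemma orientation_exists:
  assumes "finite W" "F \<subseteq> W \<times> W" "sym F" "irrefl F"
  obtains F' where "pattern W F'" "F' \<subseteq> F" "F \<subseteq> F' \<union> F'\<inverse>"
proof -
  obtain f :: "'a \<Rightarrow> nat" where f: "inj_on f W" using finite_imp_inj_to_nat_seg[OF assms(1)] by blast
  \<comment> \<open>Keeping the direction in which an injection into the naturals increases gives an
    asymmetric relation that retains every edge once.\<close>
  let ?F' = "{(x, y) \<in> F. f x < f y}"
  have "pattern W ?F'" using assms(1,2) by unfold_locales auto
  moreover have "F \<subseteq> ?F' \<union> ?F'\<inverse>"
  proof
    fix p assume p: "p \<in> F"
    obtain x y where xy: "p = (x, y)" by (cases p)
    then have "f x \<noteq> f y" using p assms f by (auto simp: irrefl_def dest: inj_onD)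
    then show "p \<in> ?F' \<union> ?F'\<inverse>" using p xy assms(3) by (auto dest: symD)
  qed
  ultimately show thesis by (intro that[of ?F']) auto
qed

lemma emb_orientation:
  assumes "F' \<subseteq> F" "F \<subseteq> F' \<union> F'\<inverse>" "sym E"
  shows "emb W F V E = emb W F' V E"
proof -
  have "(\<forall>(x, y)\<in>F. (\<phi> x, \<phi> y) \<in> E) \<longleftrightarrow> (\<forall>(x, y)\<in>F'. (\<phi> x, \<phi> y) \<in> E)" for \<phi>
    using assms by (fast dest: symD)
  then show ?thesis by (simp add: emb_def)
qed

text \<open>Without a missing pair, \<open>K\<close> would span a complete digraph inside
  \<open>G\<close>. The resulting form of clique-freeness refers only to vertex subsets, so it
  passes to every smaller vertex set in the induction.\<close>

lemma clique_free_iff: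
  assumes "pair_graph G" "clique_free k G" "K \<subseteq> pverts G" "card K = k"
  shows "\<exists>u\<in>K. \<exists>v\<in>K. u \<noteq> v \<and> (u, v) \<notin> parcs G"
proof (rule ccontr)
  interpret pair_graph G by (rule assms(1))
  assume "\<not> ?thesis"
  then have all: "(u, v) \<in> parcs G" if "u \<in> K" "v \<in> K" "u \<noteq> v" for u v using that by blast
  define K' where "K' = \<lparr>pverts = K, parcs = {(u, v). u \<in> K \<and> v \<in> K \<and> u \<noteq> v}\<rparr>"
  have finK: "finite K" using assms(3) finite_verts by (auto intro: finite_subset)
  have "pair_graph K'"
    unfolding K'_def using finK
    by unfold_locales (auto simp: symmetric_def intro: symI finite_subset[of _ "K \<times> K"])
  then interpret K': pair_graph K' .
  have "complete_digraph k (with_proj K')"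
    unfolding complete_digraph_def using K'.graph_axioms assms(4) by (auto simp: K'_def)
  moreover have "subgraph (with_proj K') (with_proj G)"
    using assms(3) all K'.wf_digraph_axioms wf_digraph_axioms by (intro subgraphI) (auto simp: K'_def)
  ultimately show False using assms(2) unfolding clique_free_def by blast
qed

theorem theorem1p6:
  fixes H :: "'a pair_pre_digraph" and G :: "'b pair_pre_digraph" and T :: "'c pair_pre_digraph"
    and r n :: nat
  assumes "pair_graph H" and "card (pverts H) \<ge> 1"
    and "r \<ge> 40 * card (pverts H) ^ 3"
    and "n \<ge> 1"
    and "pair_graph G" and "card (pverts G) = n" and "clique_free (r + 1) G"
    and "turan_graph r n T"
  shows "inj_count H G \<le> inj_count H T"
proof -
  interpret H: pair_graph H by (rule assms(1))
  interpret G: pair_graph G by (rule assms(5))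
  have symG: "sym (parcs G)" "irrefl (parcs G)" and symH: "sym (parcs H)" "irrefl (parcs H)"
    using G.sym_arcs H.sym_arcs G.no_loops' H.no_loops' by (auto simp: symmetric_def irrefl_def)
  have H: "finite (pverts H)" "parcs H \<subseteq> pverts H \<times> pverts H"
    using H.arc_fst_in_verts H.arc_snd_in_verts by fastforce+
  obtain P where T: "pair_graph T" "card (pverts T) = n" and P: "pverts T = (\<Union>i<r. P i)"
      "disjoint_family_on P {..<r}" "\<And>i. i < r \<Longrightarrow> int (card (P i)) \<in> {\<lfloor>real n / real r\<rfloor>, \<lceil>real n / real r\<rceil>}"
      "parcs T = {(u, v). \<exists>i<r. \<exists>j<r. i \<noteq> j \<and> u \<in> P i \<and> v \<in> P j}"
    using assms(8) unfolding turan_graph_def by blast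
  \<comment> \<open>Disjointness of the parts makes the index unique on \<open>pverts T\<close>;
    outside that set the value is arbitrary.\<close>
  define c where "c v = (THE i. i < r \<and> v \<in> P i)" for v
  have c: "c v = i" if "i < r" "v \<in> P i" for i v
    unfolding c_def using that P(2) by (intro the_equality) (auto simp: disjoint_family_on_def)
  have cls: "color_class (pverts T) c i = P i" if "i < r" for i
    using that P(1) c by (auto simp: color_class_def)
  have "balanced r (pverts T) c"
    unfolding balanced_def
  proof (intro conjI allI impI)
    show "c ` pverts T \<subseteq> {..<r}" using P(1) c by auto
    fix i j assume ij: "i < r" "j < r"
    have "\<lceil>real n / real r\<rceil> \<le> \<lfloor>real n / real r\<rfloor> + 1" "\<lfloor>real n / real r\<rfloor> \<le> \<lceil>real n / real r\<rceil>" by linarith+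
    moreover have "int (card (P k)) = \<lfloor>real n / real r\<rfloor> \<or> int (card (P k)) = \<lceil>real n / real r\<rceil>"
      if "k < r" for k using P(3)[OF that] by simp
    note this[OF ij(1)] this[OF ij(2)]
    ultimately have "int (card (P i)) \<le> int (card (P j)) + 1" by (elim disjE; linarith)
    then show "card (color_class (pverts T) c i) \<le> card (color_class (pverts T) c j) + 1"
      using cls ij by simp
  qed
  have parcsT: "(u, v) \<in> parcs T \<longleftrightarrow> (u, v) \<in> multipartite c" if "u \<in> pverts T" "v \<in> pverts T" for u v
  proof -
    obtain a b where "a < r" "u \<in> P a" "b < r" "v \<in> P b" using \<open>u \<in> pverts T\<close> \<open>v \<in> pverts T\<close> P(1) by blast
    moreover from this have "(u, v) \<in> parcs T \<longleftrightarrow> a \<noteq> b" unfolding P(4) using c by blast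
    ultimately show ?thesis using c by (simp add: multipartite_def)
  qed
  obtain F where F: "pattern (pverts H) F" "F \<subseteq> parcs H" "parcs H \<subseteq> F \<union> F\<inverse>"
    using orientation_exists[OF H symH] by blast
  interpret pattern "pverts H" F by (rule F(1))
  interpret T: pair_graph T by (rule T(1))
  have "finite (pverts T)" by (rule T.pair_finite_verts)
  \<comment> \<open>One direction per pattern edge suffices for both counts, because both target
    relations are symmetric.\<close>
  have "inj_count H G = card (emb (pverts H) F (pverts G) (parcs G))"
    using emb_orientation[OF F(2,3) symG(1)] by (simp add: inj_count_def emb_def)
  also have "\<dots> \<le> card (emb (pverts H) F (pverts T) (multipartite c))"
    using assms(2,3,6) symG clique_free_iff[OF assms(5,7)] T(2) \<open>finite (pverts T)\<close> \<open>balanced r (pverts T) c\<close>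
    by (intro card_emb_le_balanced[where n = n and r = r]) auto
  also have "emb (pverts H) F (pverts T) (multipartite c) = emb (pverts H) (parcs H) (pverts T) (multipartite c)"
    by (rule emb_orientation[OF F(2,3), symmetric]) (auto simp: multipartite_def sym_def)
  also have "\<dots> = emb (pverts H) (parcs H) (pverts T) (parcs T)"
    using H(2) parcsT unfolding emb_def by (fastforce simp: PiE_def Pi_def)
  also have "card \<dots> = inj_count H T" by (simp add: inj_count_def emb_def)
  finally show ?thesis .
qed

end
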